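(* For a Tychonoff space $X$ the following conditions are equivalent: (1) $C_p(X)$ is Polishable; (2) $C_k(X)$ is Polish; (3) $X$ is a submetrizable hemicompact $k$-space.
   Context: For a Tychonoff space $X$, $C_p(X)$ (respectively $C_k(X)$) is the vector space of continuous real-valued functions on $X$ with the topology of pointwise convergence (respectively with the compact-open topology). A locally convex space is Polishable if it admits a stronger (i.e. finer) separable Fréchet (complete metrizable locally convex) vector space topology. A topological space is Polish if it is separable and completely metrizable. A topological space $X$ is: submetrizable if it admits a continuous metric; hemicompact if it has a countable family $\mathcal{K}$ of compact sets such that each compact subset of $X$ is contained in some $K\in\mathcal{K}$; a $k$-space if a subset $F\subset X$ is closed if and only if for every compact subset $K\subset X$ the intersection $F\cap K$ is closed in $K$. *)

theory Defs
  imports "HOL-Analysis.Analysis" "HOL-Library.Function_Algebras"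
begin

section \<open>Real-valued functions as a real vector space\<close>

instantiation "fun" :: (type, real_vector) real_vector
begin

definition scaleR_fun_def: "c *\<^sub>R f = (\<lambda>x. c *\<^sub>R f x)"

instance
  by standard (simp_all add: scaleR_fun_def fun_eq_iff algebra_simps)

end

lemma scaleR_fun_apply [simp]: "(c *\<^sub>R f) x = c *\<^sub>R f x"
  by (simp add: scaleR_fun_def)


section \<open>Topological vector spaces\<close>

text \<open>A topological vector space is given by its topology alone: the points form a linear
  subspace of an ambient real vector space and carry the induced linear structure.\<close>

definition topological_vector_space :: "'v::real_vector topology \<Rightarrow> bool" where
  "topological_vector_space T \<longleftrightarrow>
     subspace (topspace T) \<and>
     continuous_map (prod_topology T T) T (\<lambda>(x, y). x + y) \<and>
     continuous_map (prod_topology euclideanreal T) T (\<lambda>(c, x). c *\<^sub>R x)"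

definition locally_convex_space :: "'v::real_vector topology \<Rightarrow> bool" where
  "locally_convex_space T \<longleftrightarrow>
     topological_vector_space T \<and>
     (\<forall>U. openin T U \<and> 0 \<in> U \<longrightarrow>
        (\<exists>V. openin T V \<and> convex V \<and> 0 \<in> V \<and> V \<subseteq> U))"

text \<open>Translation invariance makes completeness of the metric the same as completeness of the
  topological vector space.\<close>

definition frechet_space :: "'v::real_vector topology \<Rightarrow> bool" where
  "frechet_space T \<longleftrightarrow>
     locally_convex_space T \<and>
     (\<exists>d. Metric_space (topspace T) d \<and>
          Metric_space.mtopology (topspace T) d = T \<and>
          Metric_space.mcomplete (topspace T) d \<and>
          (\<forall>x\<in>topspace T. \<forall>y\<in>topspace T. \<forall>z\<in>topspace T. d (x + z) (y + z) = d x y))"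

definition polishable :: "'v::real_vector topology \<Rightarrow> bool" where
  "polishable T \<longleftrightarrow>
     (\<exists>T'. topspace T' = topspace T \<and>
           (\<forall>U. openin T U \<longrightarrow> openin T' U) \<and>
           frechet_space T' \<and> separable_space T')"


section \<open>Classes of topological spaces\<close>

text \<open>The library's \<^const>\<open>completely_regular_space\<close> includes no separation of points.\<close>

definition tychonoff_space :: "'a topology \<Rightarrow> bool" where
  "tychonoff_space X \<longleftrightarrow> completely_regular_space X \<and> Hausdorff_space X"

definition polish_topology :: "'a topology \<Rightarrow> bool" where
  "polish_topology X \<longleftrightarrow> separable_space X \<and> completely_metrizable_space X"

text \<open>The metric need not generate the topology of \<open>X\<close>.\<close>

definition submetrizable_space :: "'a topology \<Rightarrow> bool" where
  "submetrizable_space X \<longleftrightarrow>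
     (\<exists>d. Metric_space (topspace X) d \<and>
          continuous_map (prod_topology X X) euclideanreal (\<lambda>(x, y). d x y))"

definition hemicompact_space :: "'a topology \<Rightarrow> bool" where
  "hemicompact_space X \<longleftrightarrow>
     (\<exists>\<K>. countable \<K> \<and> (\<forall>K\<in>\<K>. compactin X K) \<and>
          (\<forall>C. compactin X C \<longrightarrow> (\<exists>K\<in>\<K>. C \<subseteq> K)))"


section \<open>Function spaces\<close>

text \<open>Since HOL functions are total, a continuous function on \<open>X\<close> is represented by its
  extension by zero outside \<^term>\<open>topspace X\<close>. This makes the representation unique and
  compatible with the pointwise linear operations.\<close>

definition continuous_functions :: "'a topology \<Rightarrow> ('a \<Rightarrow> real) set" where
  "continuous_functions X =
     {f. continuous_map X euclideanreal f \<and> (\<forall>x. x \<notin> topspace X \<longrightarrow> f x = 0)}"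

text \<open>Coordinates outside \<^term>\<open>topspace X\<close> are constantly zero on these functions, so the full
  product topology induces pointwise convergence on \<^term>\<open>topspace X\<close>.\<close>

definition Cp :: "'a topology \<Rightarrow> ('a \<Rightarrow> real) topology" where
  "Cp X = subtopology (product_topology (\<lambda>_. euclideanreal) UNIV) (continuous_functions X)"

definition Ck :: "'a topology \<Rightarrow> ('a \<Rightarrow> real) topology" where
  "Ck X = topology_generated_by
     {{f \<in> continuous_functions X. f ` K \<subseteq> U} | K U. compactin X K \<and> open U}"

lemma topspace_Cp [simp]: "topspace (Cp X) = continuous_functions X"
  by (simp add: Cp_def)

lemma topspace_Ck [simp]: "topspace (Ck X) = continuous_functions X"
proof -
  have "continuous_functions X \<in>
      {{f \<in> continuous_functions X. f ` K \<subseteq> U} | K U. compactin X K \<and> open U}"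
    by (force intro: exI[of _ "{}"])
  then show ?thesis
    unfolding Ck_def topology_generated_by_topspace by blast
qed

lemma subspace_continuous_functions: "subspace (continuous_functions X)"
  unfolding subspace_def continuous_functions_def
  by (auto intro!: continuous_map_add continuous_map_real_mult simp: zero_fun_def plus_fun_def scaleR_fun_def)

lemma continuous_map_Cp_apply: "continuous_map (Cp X) euclideanreal (\<lambda>f. f x)"
  unfolding Cp_def
  by (intro continuous_map_from_subtopology continuous_map_product_projection UNIV_I)

lemma locally_convex_space_Cp: "locally_convex_space (Cp X)"
  unfolding locally_convex_space_def topological_vector_space_def
proof (intro conjI allI impI)
  have sub: "subspace (continuous_functions X)"
    by (rule subspace_continuous_functions)
  then show "subspace (topspace (Cp X))"
    by simp
  have into: "continuous_map Z (Cp X) g"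
    if "\<And>x. continuous_map Z euclideanreal (\<lambda>z. g z x)"
      and "\<And>z. z \<in> topspace Z \<Longrightarrow> g z \<in> continuous_functions X"
    for Z :: "'b topology" and g
    using that by (auto simp: Cp_def continuous_map_in_subtopology continuous_map_componentwise_UNIV)
  show "continuous_map (prod_topology (Cp X) (Cp X)) (Cp X) (\<lambda>(f, g). f + g)"
  proof (rule into)
    show "continuous_map (prod_topology (Cp X) (Cp X)) euclideanreal
            (\<lambda>z. (case z of (f, g) \<Rightarrow> f + g) x)" for x
      unfolding case_prod_unfold plus_fun_apply
      by (intro continuous_map_add
          continuous_map_compose[OF continuous_map_fst continuous_map_Cp_apply, unfolded o_def]
          continuous_map_compose[OF continuous_map_snd continuous_map_Cp_apply, unfolded o_def])
  qed (use sub in \<open>auto intro: subspace_add\<close>)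
  show "continuous_map (prod_topology euclideanreal (Cp X)) (Cp X) (\<lambda>(c, f). c *\<^sub>R f)"
  proof (rule into)
    show "continuous_map (prod_topology euclideanreal (Cp X)) euclideanreal
            (\<lambda>z. (case z of (c, f) \<Rightarrow> c *\<^sub>R f) x)" for x
      unfolding case_prod_unfold scaleR_fun_apply real_scaleR_def
      by (intro continuous_map_real_mult continuous_map_fst
          continuous_map_compose[OF continuous_map_snd continuous_map_Cp_apply, unfolded o_def])
  qed (use sub in \<open>auto intro: subspace_scale\<close>)
  fix U assume U: "openin (Cp X) U \<and> 0 \<in> U"
  then obtain W where W: "openin (product_topology (\<lambda>_. euclideanreal) UNIV) W"
    and UW: "U = W \<inter> continuous_functions X" and "0 \<in> W"
    by (auto simp: Cp_def openin_subtopology)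
  obtain B where B0: "0 \<in> Pi\<^sub>E UNIV B" and B: "\<And>i. open (B i)" "finite {i. B i \<noteq> UNIV}"
    and BW: "Pi\<^sub>E UNIV B \<subseteq> W"
    using product_topology_open_contains_basis[OF W \<open>0 \<in> W\<close>] by auto
  have "\<exists>e>0. ball 0 e \<subseteq> B i" for i
    using B(1)[of i] B0 by (metis PiE_iff UNIV_I open_contains_ball zero_fun_apply)
  then obtain e where e: "\<And>i. e i > 0" "\<And>i. ball 0 (e i) \<subseteq> B i"
    by metis
  define D where "D i = (if B i = UNIV then UNIV else ball (0::real) (e i))" for i
  define V where "V = Pi\<^sub>E UNIV D \<inter> continuous_functions X"
  have "convex (Pi\<^sub>E UNIV D)"
  proof (rule convexI)
    fix f g and u v :: real
    assume *: "f \<in> Pi\<^sub>E UNIV D" "g \<in> Pi\<^sub>E UNIV D" "0 \<le> u" "0 \<le> v" "u + v = 1"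
    have "u *\<^sub>R f i + v *\<^sub>R g i \<in> D i" for i
      by (rule convexD) (use * in \<open>auto simp: D_def PiE_iff\<close>)
    then show "u *\<^sub>R f + v *\<^sub>R g \<in> Pi\<^sub>E UNIV D"
      by (simp add: PiE_iff)
  qed
  then have "convex V"
    unfolding V_def by (rule convex_Int) (rule subspace_imp_convex[OF sub])
  moreover have "openin (Cp X) V"
  proof -
    have "finite {i. D i \<noteq> UNIV}"
      by (rule finite_subset[OF _ B(2)]) (auto simp: D_def)
    then have "openin (product_topology (\<lambda>_. euclideanreal) UNIV) (Pi\<^sub>E UNIV D)"
      by (intro product_topology_basis) (auto simp: D_def)
    then show ?thesis
      unfolding Cp_def V_def openin_subtopology by blast
  qed
  moreover have "0 \<in> V"
    using e(1) subspace_0[OF sub] by (auto simp: V_def D_def PiE_iff)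
  moreover have "V \<subseteq> U"
    using e(2) BW unfolding V_def UW D_def by (fastforce simp: PiE_iff split: if_splits)
  ultimately show "\<exists>V. openin (Cp X) V \<and> convex V \<and> 0 \<in> V \<and> V \<subseteq> U"
    by blast
qed

end

theory Submission
  imports Defs
begin

text \<open>
  Everything turns on the functions that are continuous on each set of a sequence
  \<open>K 0 \<subseteq> K 1 \<subseteq> \<dots>\<close> of compact sets that is cofinal among all compact sets. Uniform convergence on
  these stages is given by a translation-invariant metric, for which the functions that are
  continuous on every stage form a complete space \<open>Z\<close> (\<open>mcomplete_stagewise\<close>). The continuous
  functions are a subspace of \<open>Z\<close>, the subspace topology is the compact-open one
  (\<open>Ck_eq_mtopology\<close>), and by Tietze's theorem they are dense. For Hausdorff \<open>X\<close> the k-property amounts to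
  \<open>Z\<close> containing nothing but continuous functions (\<open>k_space_imp_stagewise\<close>,
  \<open>stagewise_imp_k_space\<close>).

  If \<open>X\<close> is a submetrizable hemicompact k-space, then \<^term>\<open>Ck X\<close> is therefore a Frechet space. It is
  separable, because some sequence of continuous functions separates the points, and by
  Stone and Weierstrass the polynomials in it with rational coefficients are dense. This space
  is Polish, and it witnesses that \<^term>\<open>Cp X\<close> is Polishable.

  For the converses, a separable topology finer than that of \<^term>\<open>Cp X\<close> contains a countable set
  that is pointwise dense and hence separates points, so \<open>X\<close> is submetrizable. What remains is
  hemicompactness and the equality of \<open>Z\<close> with the set of continuous functions.

  If \<^term>\<open>Ck X\<close> is Polish, then a countable neighbourhood base at \<open>0\<close> makes \<open>X\<close> hemicompact, and complete
  metrizability makes the continuous functions a dense \<open>G\<^sub>\<delta>\<close> subset of \<open>Z\<close>. If \<open>f \<in> Z\<close> were not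
  continuous, its coset would be a disjoint dense \<open>G\<^sub>\<delta>\<close> subset, contradicting Baire's theorem.

  Let now \<open>T\<close> be a separable Frechet topology finer than that of \<^term>\<open>Cp X\<close>. By the argument of Banach
  and Steinhaus every compact set lies in the polar of a \<open>T\<close>-neighbourhood of \<open>0\<close>. The polars,
  cut by a dense sequence, form a countable network, so \<open>X\<close> is Lindelof. In a Lindelof space a
  closed set is compact as soon as every continuous function is bounded on it; the polars
  are such sets, and \<open>X\<close> is hemicompact. The main step is that \<^term>\<open>Ck X\<close> is barrelled
  (\<open>Lindelof_Ck_barrelled\<close>, after Nachbin and Shirota): the compact-open closures of \<open>T\<close>-neighbourhoods are
  neighbourhoods. As in the proof of the open mapping theorem, any \<open>f \<in> Z\<close> can then be approached
  by a \<open>T\<close>-Cauchy sequence, whose limit is continuous.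
\<close>

section \<open>Continuous functions and the compact-open topology\<close>

definition zero_extension :: "'a topology \<Rightarrow> ('a \<Rightarrow> real) \<Rightarrow> 'a \<Rightarrow> real" where
  "zero_extension X f = (\<lambda>x. if x \<in> topspace X then f x else 0)"

lemma zero_extension_apply [simp]: "x \<in> topspace X \<Longrightarrow> zero_extension X f x = f x"
  by (simp add: zero_extension_def)

lemma zero_extension_outside [simp]: "x \<notin> topspace X \<Longrightarrow> zero_extension X f x = 0"
  by (simp add: zero_extension_def)

lemma zero_extension_continuous_functions:
  assumes "continuous_map X euclideanreal f"
  shows "zero_extension X f \<in> continuous_functions X"
  using continuous_map_eq[OF assms] by (simp add: continuous_functions_def)

lemma continuous_functionsD:
  assumes "f \<in> continuous_functions X"
  shows "continuous_map X euclideanreal f" "x \<notin> topspace X \<Longrightarrow> f x = 0"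
  using assms by (auto simp: continuous_functions_def)

lemma continuous_functions_zero: "0 \<in> continuous_functions X"
  by (rule subspace_0[OF subspace_continuous_functions])

lemma continuous_functions_add:
  "f \<in> continuous_functions X \<Longrightarrow> g \<in> continuous_functions X \<Longrightarrow> f + g \<in> continuous_functions X"
  by (rule subspace_add[OF subspace_continuous_functions])

lemma continuous_functions_diff:
  "f \<in> continuous_functions X \<Longrightarrow> g \<in> continuous_functions X \<Longrightarrow> f - g \<in> continuous_functions X"
  by (rule subspace_diff[OF subspace_continuous_functions])

lemma continuous_functions_scale:
  "f \<in> continuous_functions X \<Longrightarrow> c *\<^sub>R f \<in> continuous_functions X"
  by (rule subspace_scale[OF subspace_continuous_functions])

lemma continuous_functions_uminus:
  "f \<in> continuous_functions X \<Longrightarrow> - f \<in> continuous_functions X"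
  by (rule subspace_neg[OF subspace_continuous_functions])

lemma continuous_functions_sum:
  "(\<And>i. i \<in> I \<Longrightarrow> f i \<in> continuous_functions X) \<Longrightarrow> sum f I \<in> continuous_functions X"
  by (rule subspace_sum[OF subspace_continuous_functions])

lemma continuous_functions_mult:
  "f \<in> continuous_functions X \<Longrightarrow> g \<in> continuous_functions X \<Longrightarrow> f * g \<in> continuous_functions X"
  by (auto simp: continuous_functions_def times_fun_def intro: continuous_map_real_mult)

lemma continuous_real_compose:
  assumes "continuous_map X euclideanreal f" "continuous_on UNIV F"
  shows "continuous_map X euclideanreal (\<lambda>x. F (f x) :: real)"
  using continuous_map_compose[OF assms(1), of euclideanreal F] assms(2)
  by (simp add: o_def)

lemma continuous_real_iff:
  "continuous_map X euclideanreal f \<longleftrightarrow>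
    (\<forall>x\<in>topspace X. \<forall>e>0. \<exists>U. openin X U \<and> x \<in> U \<and> (\<forall>y\<in>U. \<bar>f y - f x\<bar> < e))"
  using Met_TC.continuous_map_to_metric[of X f]
  by (simp add: dist_real_def abs_minus_commute)

text \<open>The usual argument for uniform limits needs only one approximating function for each point and
  each accuracy. This form covers locally uniform series as well as uniform limits on a stage.\<close>

lemma continuous_real_local_approx:
  assumes "\<And>x e. x \<in> topspace X \<Longrightarrow> e > 0 \<Longrightarrow>
     \<exists>U g. openin X U \<and> x \<in> U \<and> continuous_map X euclideanreal g \<and> (\<forall>y\<in>U. \<bar>f y - g y\<bar> \<le> e)"
  shows "continuous_map X euclideanreal f"
  unfolding continuous_real_iff
proof (intro ballI allI impI)
  fix x and e :: real assume x: "x \<in> topspace X" "e > 0"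
  obtain U g where U: "openin X U" "x \<in> U" and g: "continuous_map X euclideanreal g"
    and Ug: "\<forall>y\<in>U. \<bar>f y - g y\<bar> \<le> e/4"
    using assms[OF x(1), of "e/4"] x(2) by auto
  obtain W where W: "openin X W" "x \<in> W" and Wg: "\<forall>y\<in>W. \<bar>g y - g x\<bar> < e/4"
    using g x unfolding continuous_real_iff by (meson divide_pos_pos zero_less_numeral)
  have "\<bar>f y - f x\<bar> < e" if "y \<in> U \<inter> W" for y
  proof -
    have "\<bar>f y - g y\<bar> \<le> e/4" "\<bar>f x - g x\<bar> \<le> e/4" "\<bar>g y - g x\<bar> < e/4"
      using that Ug Wg U(2) by auto
    then show ?thesis using x(2) by linarith
  qed
  then show "\<exists>U. openin X U \<and> x \<in> U \<and> (\<forall>y\<in>U. \<bar>f y - f x\<bar> < e)"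
    using U W by (intro exI[of _ "U \<inter> W"]) auto
qed

lemma openin_real_preimage:
  assumes "continuous_map X euclideanreal f" "open A"
  shows "openin X {x \<in> topspace X. f x \<in> A}"
  using openin_continuous_map_preimage[OF assms(1), of A] assms(2) by simp

lemma closedin_real_preimage:
  assumes "continuous_map X euclideanreal f" "closed A"
  shows "closedin X {x \<in> topspace X. f x \<in> A}"
  using closedin_continuous_map_preimage[OF assms(1), of A] assms(2) by simp

lemma bounded_on_compactin:
  assumes "f \<in> continuous_functions X" "compactin X K"
  shows "\<exists>M. \<forall>x\<in>K. \<bar>f x\<bar> \<le> M"
proof -
  have "compact (f ` K)"
    using image_compactin[OF assms(2) continuous_functionsD(1)[OF assms(1)]] by simp
  then show ?thesis
    using compact_imp_bounded[of "f ` K"] unfolding bounded_real by blast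
qed

lemma compactin_Int_closed_preimage:
  assumes "f \<in> continuous_functions X" "compactin X K" "closed A"
  shows "compactin X (K \<inter> {x. f x \<in> A})"
proof -
  have "K \<inter> {x. f x \<in> A} = {x \<in> topspace X. f x \<in> A} \<inter> K"
    using compactin_subset_topspace[OF assms(2)] by auto
  then show ?thesis
    using closed_Int_compactin[OF closedin_real_preimage[OF continuous_functionsD(1)[OF assms(1)] assms(3)] assms(2)]
    by simp
qed

definition uniform_ball :: "'a topology \<Rightarrow> 'a set \<Rightarrow> real \<Rightarrow> ('a \<Rightarrow> real) \<Rightarrow> ('a \<Rightarrow> real) set" where
  "uniform_ball X K e f = {g \<in> continuous_functions X. \<forall>x\<in>K. \<bar>g x - f x\<bar> < e}"

lemma uniform_ball_mono:
  "K \<subseteq> K' \<Longrightarrow> e' \<le> e \<Longrightarrow> uniform_ball X K' e' f \<subseteq> uniform_ball X K e f"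
  by (force simp: uniform_ball_def)

definition compact_open_subbasis :: "'a topology \<Rightarrow> ('a \<Rightarrow> real) set set" where
  "compact_open_subbasis X = {{f \<in> continuous_functions X. f ` K \<subseteq> U} | K U. compactin X K \<and> open U}"

lemma subbasis_contains_uniform_ball:
  assumes "S \<in> compact_open_subbasis X" "f \<in> S"
  shows "\<exists>K e. compactin X K \<and> e > 0 \<and> uniform_ball X K e f \<subseteq> S"
proof -
  obtain K U where S: "S = {f \<in> continuous_functions X. f ` K \<subseteq> U}" and K: "compactin X K" and U: "open U"
    using assms(1) by (auto simp: compact_open_subbasis_def)
  have f: "f \<in> continuous_functions X" "f ` K \<subseteq> U" using assms(2) S by auto
  have "compact (f ` K)"
    using image_compactin[OF K continuous_functionsD(1)[OF f(1)]] by simp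
  then obtain e where e: "e > 0" "(\<Union>y\<in>f ` K. ball y e) \<subseteq> U"
    by (rule compact_subset_open_imp_ball_epsilon_subset[OF _ U f(2)])
  have "g x \<in> U" if "g \<in> uniform_ball X K e f" "x \<in> K" for g x
  proof -
    have "g x \<in> ball (f x) e"
      using that by (simp add: uniform_ball_def dist_real_def abs_minus_commute)
    then show ?thesis using e(2) that(2) by blast
  qed
  then have "uniform_ball X K e f \<subseteq> S"
    unfolding S by (auto simp: uniform_ball_def)
  then show ?thesis using K e(1) by blast
qed

lemma uniform_ball_Int:
  assumes "\<exists>K e. compactin X K \<and> e > 0 \<and> uniform_ball X K e f \<subseteq> S"
    and "\<exists>K e. compactin X K \<and> e > 0 \<and> uniform_ball X K e f \<subseteq> T"
  shows "\<exists>K e. compactin X K \<and> e > 0 \<and> uniform_ball X K e f \<subseteq> S \<inter> T"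
proof -
  obtain K e K' e' where "compactin X K" "e > 0" "uniform_ball X K e f \<subseteq> S"
     "compactin X K'" "e' > 0" "uniform_ball X K' e' f \<subseteq> T"
    using assms by blast
  moreover have "uniform_ball X (K \<union> K') (min e e') f \<subseteq> uniform_ball X K e f"
    "uniform_ball X (K \<union> K') (min e e') f \<subseteq> uniform_ball X K' e' f"
    by (rule uniform_ball_mono; simp)+
  ultimately show ?thesis
    by (intro exI[of _ "K \<union> K'"] exI[of _ "min e e'"]) (auto intro: compactin_Un)
qed

text \<open>Covering \<open>K\<close> by finitely many compact pieces on which \<open>f\<close> oscillates little turns the uniform
  estimate into finitely many subbasic conditions.\<close>

lemma uniform_ball_contains_open:
  assumes f: "f \<in> continuous_functions X" and K: "compactin X K" and e: "e > 0"
  shows "\<exists>O'. openin (Ck X) O' \<and> f \<in> O' \<and> O' \<subseteq> uniform_ball X K e f"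
proof -
  have "compact (f ` K)"
    using image_compactin[OF K continuous_functionsD(1)[OF f]] by simp
  then obtain D where D: "finite D" "f ` K \<subseteq> (\<Union>t\<in>D. ball t (e/4))"
    using e compact_eq_totally_bounded[of "f ` K"] by (meson divide_pos_pos zero_less_numeral)
  define P where "P t = K \<inter> {x. f x \<in> cball t (e/4)}" for t
  define S where "S t = {g \<in> continuous_functions X. g ` P t \<subseteq> ball t (e/2)}" for t
  have "openin (Ck X) (S t)" for t
  proof -
    have "compactin X (P t)"
      unfolding P_def by (rule compactin_Int_closed_preimage[OF f K]) simp
    then show ?thesis
      unfolding Ck_def S_def by (intro topology_generated_by_Basis) blast
  qed
  moreover have "openin (Ck X) (continuous_functions X)"
    using openin_topspace[of "Ck X"] by simp
  ultimately have op: "openin (Ck X) (continuous_functions X \<inter> (\<Inter>t\<in>D. S t))"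
    using D(1) by (intro openin_Int_Inter) auto
  have "f \<in> S t" for t
    using f e by (auto simp: S_def P_def)
  moreover have "continuous_functions X \<inter> (\<Inter>t\<in>D. S t) \<subseteq> uniform_ball X K e f"
  proof
    fix g assume g: "g \<in> continuous_functions X \<inter> (\<Inter>t\<in>D. S t)"
    have "\<bar>g x - f x\<bar> < e" if x: "x \<in> K" for x
    proof -
      obtain t where t: "t \<in> D" "f x \<in> ball t (e/4)" using D(2) x by blast
      then have "x \<in> P t" using x by (simp add: P_def)
      then have "g x \<in> ball t (e/2)"
        using g t(1) by (auto simp: S_def image_subset_iff)
      then show ?thesis using t(2) unfolding mem_ball dist_real_def by linarith
    qed
    then show "g \<in> uniform_ball X K e f" using g by (simp add: uniform_ball_def)
  qed
  ultimately show ?thesis using op f by blast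
qed

text \<open>The subbasis of the compact-open topology is hard to compute with. All later arguments use
  only this description by uniform convergence on compact sets.\<close>

proposition openin_Ck:
  "openin (Ck X) U \<longleftrightarrow> U \<subseteq> continuous_functions X \<and>
     (\<forall>f\<in>U. \<exists>K e. compactin X K \<and> e > 0 \<and> uniform_ball X K e f \<subseteq> U)"
proof
  assume U: "openin (Ck X) U"
  then have "generate_topology_on (compact_open_subbasis X) U"
    by (simp add: Ck_def compact_open_subbasis_def openin_topology_generated_by_iff)
  then have "\<forall>f\<in>U. \<exists>K e. compactin X K \<and> e > 0 \<and> uniform_ball X K e f \<subseteq> U"
  proof induction
    case (Int a b)
    then show ?case using uniform_ball_Int by (metis IntD1 IntD2)
  next
    case (UN \<K>)
    then show ?case by (meson UnionE Union_upper order_trans)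
  next
    case (Basis s)
    then show ?case using subbasis_contains_uniform_ball by blast
  qed simp
  then show "U \<subseteq> continuous_functions X \<and>
     (\<forall>f\<in>U. \<exists>K e. compactin X K \<and> e > 0 \<and> uniform_ball X K e f \<subseteq> U)"
    using openin_subset[OF U] by simp
next
  assume U: "U \<subseteq> continuous_functions X \<and>
     (\<forall>f\<in>U. \<exists>K e. compactin X K \<and> e > 0 \<and> uniform_ball X K e f \<subseteq> U)"
  then have "\<exists>O'. openin (Ck X) O' \<and> f \<in> O' \<and> O' \<subseteq> U" if "f \<in> U" for f
    using that uniform_ball_contains_open by (metis (no_types, opaque_lifting) order_trans subsetD)
  then show "openin (Ck X) U"
    by (subst openin_subopen) blast
qed

lemma openin_CkD:
  assumes "openin (Ck X) U" "f \<in> U"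
  shows "\<exists>K e. compactin X K \<and> e > 0 \<and> uniform_ball X K e f \<subseteq> U"
  using assms unfolding openin_Ck by blast

lemma Ck_finer_than_Cp: "openin (Cp X) U \<Longrightarrow> openin (Ck X) U"
proof -
  have "continuous_map (Ck X) euclideanreal (\<lambda>f. f x)" for x
    unfolding continuous_real_iff
  proof (intro ballI allI impI)
    fix f and e :: real assume f: "f \<in> topspace (Ck X)" and e: "e > 0"
    show "\<exists>U. openin (Ck X) U \<and> f \<in> U \<and> (\<forall>g\<in>U. \<bar>g x - f x\<bar> < e)"
    proof (cases "x \<in> topspace X")
      case True
      then obtain O' where "openin (Ck X) O'" "f \<in> O'" "O' \<subseteq> uniform_ball X {x} e f"
        using uniform_ball_contains_open[of f X "{x}" e] f e by auto
      then show ?thesis by (auto simp: uniform_ball_def)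
    next
      case False
      then have "\<bar>g x - f x\<bar> < e" if "g \<in> continuous_functions X" for g
        using that f e by (simp add: continuous_functionsD(2))
      then show ?thesis
        using f openin_topspace[of "Ck X"] by (intro exI[of _ "continuous_functions X"]) auto
    qed
  qed
  then have "continuous_map (Ck X) (Cp X) id"
    by (auto simp: Cp_def continuous_map_in_subtopology continuous_map_componentwise_UNIV)
  moreover assume U: "openin (Cp X) U"
  ultimately have "openin (Ck X) {f \<in> topspace (Ck X). id f \<in> U}"
    by (rule openin_continuous_map_preimage)
  moreover have "{f \<in> topspace (Ck X). id f \<in> U} = U"
    using openin_subset[OF U] by auto
  ultimately show "openin (Ck X) U" by simp
qed

section \<open>The stagewise metric of a hemicompact space\<close>

text \<open>Cofinality among the compact sets is more than covering: it makes the suprema over the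
  stages generate the compact-open topology.\<close>

locale compact_exhaustion =
  fixes X :: "'a topology" and K :: "nat \<Rightarrow> 'a set"
  assumes compactin_stage: "compactin X (K n)"
    and incseq_stages: "incseq K"
    and cofinal_stages: "compactin X C \<Longrightarrow> \<exists>n. C \<subseteq> K n"

lemma hemicompact_space_imp_compact_exhaustion:
  assumes "hemicompact_space X"
  shows "\<exists>K. compact_exhaustion X K"
proof -
  obtain \<K> where \<K>: "countable \<K>" "\<And>K. K \<in> \<K> \<Longrightarrow> compactin X K"
    "\<And>C. compactin X C \<Longrightarrow> \<exists>K\<in>\<K>. C \<subseteq> K"
    using assms unfolding hemicompact_space_def by blast
  have ne: "\<K> \<noteq> {}" using \<K>(3)[of "{}"] by auto
  define L where "L = from_nat_into \<K>"
  define K where "K n = (\<Union>i\<le>n. L i)" for n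
  have "compact_exhaustion X K"
  proof
    show "compactin X (K n)" for n
      unfolding K_def using \<K>(2) from_nat_into[OF ne] by (intro compactin_Union) (auto simp: L_def)
    show "incseq K"
      unfolding K_def incseq_def by (intro allI impI UN_mono) auto
    fix C assume "compactin X C"
    then obtain D where "D \<in> \<K>" "C \<subseteq> D" using \<K>(3) by blast
    then show "\<exists>n. C \<subseteq> K n"
      using from_nat_into_surj[OF \<K>(1), of D] unfolding K_def L_def by blast
  qed
  then show ?thesis by blast
qed

context compact_exhaustion
begin

definition stagewise_continuous :: "('a \<Rightarrow> real) set" where
  "stagewise_continuous = {f. (\<forall>n. continuous_map (subtopology X (K n)) euclideanreal f) \<and>
     (\<forall>x. x \<notin> topspace X \<longrightarrow> f x = 0)}"

text \<open>Instead of a series of truncated suprema, a single weighted supremum is used: a point that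
  first appears in stage \<open>n\<close> contributes at most \<open>1 / (n + 1)\<close>. Once \<open>stage_dist f g\<close> is less than \<open>1 / (n + 1)\<close>, it
  bounds the difference on stage \<open>n\<close>. For points outside the space the weight is some
  positive number, and the functions in question agree there.\<close>

definition weight :: "'a \<Rightarrow> real" where
  "weight x = 1 / real (Suc (LEAST n. x \<in> K n))"

definition stage_dist :: "('a \<Rightarrow> real) \<Rightarrow> ('a \<Rightarrow> real) \<Rightarrow> real" where
  "stage_dist f g = (SUP x. min \<bar>f x - g x\<bar> (weight x))"

lemma stage_subset: "K n \<subseteq> topspace X"
  by (rule compactin_subset_topspace[OF compactin_stage])

lemma stages_cover: "x \<in> topspace X \<Longrightarrow> \<exists>n. x \<in> K n"
  using cofinal_stages[of "{x}"] by auto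

lemma continuous_functions_stagewise: "continuous_functions X \<subseteq> stagewise_continuous"
  by (auto simp: stagewise_continuous_def continuous_functions_def intro: continuous_map_from_subtopology)

lemma stagewise_continuous_diff:
  "f \<in> stagewise_continuous \<Longrightarrow> g \<in> stagewise_continuous \<Longrightarrow> f - g \<in> stagewise_continuous"
  by (auto simp: stagewise_continuous_def fun_diff_def intro: continuous_map_diff)

lemma stagewise_continuous_add:
  "f \<in> stagewise_continuous \<Longrightarrow> g \<in> stagewise_continuous \<Longrightarrow> f + g \<in> stagewise_continuous"
  by (auto simp: stagewise_continuous_def plus_fun_def intro: continuous_map_add)

lemma weight_pos: "weight x > 0" and weight_le_1: "weight x \<le> 1"
  by (simp_all add: weight_def)

lemma weight_ge: "x \<in> K n \<Longrightarrow> 1 / real (Suc n) \<le> weight x"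
  unfolding weight_def by (intro divide_left_mono) (auto intro: Least_le)

lemma weight_le:
  assumes "x \<in> topspace X" "x \<notin> K n"
  shows "weight x \<le> 1 / real (Suc n)"
proof -
  let ?m = "LEAST n. x \<in> K n"
  have "x \<in> K ?m" using stages_cover[OF assms(1)] by (rule LeastI_ex)
  then have "n \<le> ?m" using assms(2) incseq_stages by (meson incseqD nle_le subsetD)
  then show ?thesis unfolding weight_def by (intro divide_left_mono) auto
qed

lemma stage_dist_le_iff: "stage_dist f g \<le> e \<longleftrightarrow> (\<forall>x. min \<bar>f x - g x\<bar> (weight x) \<le> e)"
proof -
  have "bdd_above (range (\<lambda>x. min \<bar>f x - g x\<bar> (weight x)))"
    using weight_le_1 by (intro bdd_aboveI[of _ 1]) (auto simp: min_le_iff_disj)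
  then show ?thesis unfolding stage_dist_def by (simp add: cSUP_le_iff)
qed

lemma min_le_stage_dist: "min \<bar>f x - g x\<bar> (weight x) \<le> stage_dist f g"
  using stage_dist_le_iff[of f g "stage_dist f g"] by blast

lemma stage_dist_nonneg: "0 \<le> stage_dist f g"
  using min_le_stage_dist[of f undefined g] weight_pos[of undefined] by linarith

lemma stage_dist_commute: "stage_dist f g = stage_dist g f"
  by (simp add: stage_dist_def abs_minus_commute)

lemma stage_dist_translate: "stage_dist (f + h) (g + h) = stage_dist f g"
  by (simp add: stage_dist_def)

lemma stage_dist_zero: "stage_dist f g = 0 \<longleftrightarrow> f = g"
proof
  assume "stage_dist f g = 0"
  then have "\<bar>f x - g x\<bar> \<le> 0" for x
    using min_le_stage_dist[of f x g] weight_pos[of x] by linarith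
  then show "f = g" by (simp add: fun_eq_iff)
next
  assume "f = g"
  then have "stage_dist f g \<le> 0" using weight_pos by (simp add: stage_dist_le_iff less_imp_le)
  then show "stage_dist f g = 0" using stage_dist_nonneg[of f g] by linarith
qed

lemma stage_dist_triangle: "stage_dist f h \<le> stage_dist f g + stage_dist g h"
  unfolding stage_dist_le_iff
proof
  fix x
  have "min \<bar>f x - h x\<bar> (weight x) \<le> min \<bar>f x - g x\<bar> (weight x) + min \<bar>g x - h x\<bar> (weight x)"
    using weight_pos[of x] by linarith
  also have "\<dots> \<le> stage_dist f g + stage_dist g h"
    by (intro add_mono min_le_stage_dist)
  finally show "min \<bar>f x - h x\<bar> (weight x) \<le> stage_dist f g + stage_dist g h" .
qed

lemma Metric_space_stage_dist: "Metric_space M stage_dist"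
  by unfold_locales (auto simp: stage_dist_nonneg stage_dist_zero stage_dist_triangle intro: stage_dist_commute)

lemma diff_le_stage_dist:
  assumes "stage_dist f g < 1 / real (Suc n)" "x \<in> K n"
  shows "\<bar>f x - g x\<bar> \<le> stage_dist f g"
  using min_le_stage_dist[of f x g] weight_ge[OF assms(2)] assms(1) by linarith

lemma stage_dist_leI:
  assumes "\<And>x. x \<notin> topspace X \<Longrightarrow> f x = g x" "\<And>x. x \<in> K n \<Longrightarrow> \<bar>f x - g x\<bar> \<le> e"
    and "1 / real (Suc n) \<le> e"
  shows "stage_dist f g \<le> e"
  unfolding stage_dist_le_iff
proof
  fix x
  have "(0::real) \<le> 1 / real (Suc n)" by simp
  then have "0 \<le> e" using assms(3) by linarith
  consider "x \<notin> topspace X" | "x \<in> K n" | "x \<in> topspace X" "x \<notin> K n" by blast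
  then show "min \<bar>f x - g x\<bar> (weight x) \<le> e"
  proof cases
    case 1
    then show ?thesis using assms(1) \<open>0 \<le> e\<close> by (simp add: min_le_iff_disj)
  next
    case 2
    then show ?thesis using assms(2) by (simp add: min_le_iff_disj)
  next
    case 3
    then show ?thesis using weight_le[of x n] assms(3) by linarith
  qed
qed

text \<open>A Cauchy sequence converges uniformly on each stage, so its pointwise limit is again
  continuous on each stage. Continuity on all of \<open>X\<close> could be lost in the limit.\<close>

lemma mcomplete_stagewise: "Metric_space.mcomplete stagewise_continuous stage_dist"
proof -
  interpret Z: Metric_space stagewise_continuous stage_dist by (rule Metric_space_stage_dist)
  show ?thesis
    unfolding Z.mcomplete_def
  proof (intro allI impI)
    fix \<sigma> assume \<sigma>: "Z.MCauchy \<sigma>"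
    then have \<sigma>Z: "\<sigma> n \<in> stagewise_continuous" for n unfolding Z.MCauchy_def by auto
    have cau: "\<exists>N. \<forall>i\<ge>N. \<forall>j\<ge>N. stage_dist (\<sigma> i) (\<sigma> j) < e" if "e > 0" for e
      using \<sigma> that unfolding Z.MCauchy_def by simp
    have "Cauchy (\<lambda>i. \<sigma> i x)" for x
    proof (rule metric_CauchyI)
      fix e :: real assume e: "e > 0"
      obtain N where N: "\<forall>i\<ge>N. \<forall>j\<ge>N. stage_dist (\<sigma> i) (\<sigma> j) < min e (weight x)"
        using cau[of "min e (weight x)"] e weight_pos[of x] by auto
      have "dist (\<sigma> i x) (\<sigma> j x) < e" if "i \<ge> N" "j \<ge> N" for i j
      proof -
        have "min \<bar>\<sigma> i x - \<sigma> j x\<bar> (weight x) < min e (weight x)"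
          using min_le_stage_dist[of "\<sigma> i" x "\<sigma> j"] N that by force
        then show ?thesis unfolding dist_real_def by linarith
      qed
      then show "\<exists>N. \<forall>i\<ge>N. \<forall>j\<ge>N. dist (\<sigma> i x) (\<sigma> j x) < e" by blast
    qed
    then have f: "(\<lambda>i. \<sigma> i x) \<longlonglongrightarrow> f x" if "f = (\<lambda>x. lim (\<lambda>i. \<sigma> i x))" for f x
      using that by (simp add: Cauchy_convergent_iff convergent_LIMSEQ_iff)
    define f where "f = (\<lambda>x. lim (\<lambda>i. \<sigma> i x))"
    note f = f[OF f_def]
    have conv: "\<exists>N. \<forall>i\<ge>N. stage_dist (\<sigma> i) f \<le> e" if e: "e > 0" for e
    proof -
      obtain N where N: "\<forall>i\<ge>N. \<forall>j\<ge>N. stage_dist (\<sigma> i) (\<sigma> j) < e" using cau[OF e] by blast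
      have "min \<bar>\<sigma> i x - f x\<bar> (weight x) \<le> e" if i: "i \<ge> N" for i x
      proof (rule LIMSEQ_le_const2)
        show "(\<lambda>j. min \<bar>\<sigma> i x - \<sigma> j x\<bar> (weight x)) \<longlonglongrightarrow> min \<bar>\<sigma> i x - f x\<bar> (weight x)"
          by (intro tendsto_intros f)
        show "\<exists>N. \<forall>j\<ge>N. min \<bar>\<sigma> i x - \<sigma> j x\<bar> (weight x) \<le> e"
          using min_le_stage_dist N i by (meson less_imp_le order_trans)
      qed
      then show ?thesis unfolding stage_dist_le_iff by blast
    qed
    have "continuous_map (subtopology X (K n)) euclideanreal f" for n
    proof (rule continuous_real_local_approx)
      fix x and e :: real assume x: "x \<in> topspace (subtopology X (K n))" and e: "e > 0"
      \<comment> \<open>strictly below the weight of every point of stage \<open>n\<close>\<close>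
      define e' where "e' = min e (1 / real (Suc (Suc n)))"
      have e': "e' > 0" "e' \<le> e" "e' < 1 / real (Suc n)"
        using e by (auto simp: e'_def min_less_iff_disj field_simps)
      obtain N where N: "stage_dist (\<sigma> N) f \<le> e'" using conv[OF e'(1)] by blast
      have "\<bar>f y - \<sigma> N y\<bar> \<le> e" if "y \<in> K n" for y
        using diff_le_stage_dist[of "\<sigma> N" f n y] N e' that by linarith
      then show "\<exists>U g. openin (subtopology X (K n)) U \<and> x \<in> U \<and>
          continuous_map (subtopology X (K n)) euclideanreal g \<and> (\<forall>y\<in>U. \<bar>f y - g y\<bar> \<le> e)"
        using \<sigma>Z[of N] x openin_topspace[of "subtopology X (K n)"] unfolding stagewise_continuous_def
        by (intro exI[of _ "topspace (subtopology X (K n))"] exI[of _ "\<sigma> N"]) auto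
    qed
    moreover have "f x = 0" if "x \<notin> topspace X" for x
    proof -
      have "(\<lambda>i. \<sigma> i x) = (\<lambda>i. 0)"
        using \<sigma>Z that by (simp add: stagewise_continuous_def fun_eq_iff)
      then show ?thesis using f[of x] by (simp add: LIMSEQ_const_iff)
    qed
    ultimately have fZ: "f \<in> stagewise_continuous" by (simp add: stagewise_continuous_def)
    have "limitin Z.mtopology \<sigma> f sequentially"
      unfolding Z.limit_metric_sequentially
    proof (intro conjI fZ allI impI)
      fix e :: real assume "e > 0"
      then obtain N where "\<forall>i\<ge>N. stage_dist (\<sigma> i) f \<le> e/2" using conv[of "e/2"] by auto
      then show "\<exists>N. \<forall>i\<ge>N. \<sigma> i \<in> stagewise_continuous \<and> stage_dist (\<sigma> i) f < e"
        using \<sigma>Z \<open>e > 0\<close> by (intro exI[of _ N]) (auto intro: le_less_trans)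
    qed
    then show "\<exists>x. limitin Z.mtopology \<sigma> x sequentially" by blast
  qed
qed

lemma uniform_ball_subset_stage_ball:
  assumes "f \<in> continuous_functions X" "e > 0"
  shows "\<exists>n d. d > 0 \<and> (\<forall>g\<in>uniform_ball X (K n) d f. stage_dist f g < e)"
proof -
  obtain n where n: "1 / real (Suc n) < e/2"
    using nat_approx_posE[of "e/2"] assms(2) by auto
  have "stage_dist f g < e" if g: "g \<in> uniform_ball X (K n) (e/2) f" for g
  proof -
    have "stage_dist f g \<le> e/2"
    proof (rule stage_dist_leI)
      show "f x = g x" if "x \<notin> topspace X" for x
        using that assms(1) g by (simp add: uniform_ball_def continuous_functions_def)
      show "\<bar>f x - g x\<bar> \<le> e/2" if "x \<in> K n" for x
        using that g by (force simp: uniform_ball_def abs_minus_commute)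
    qed (use n in simp)
    then show ?thesis using assms(2) by simp
  qed
  then show ?thesis using assms(2) by (intro exI[of _ n] exI[of _ "e/2"]) auto
qed

lemma stage_ball_subset_uniform_ball:
  assumes "compactin X C" "e > 0"
  shows "\<exists>d>0. \<forall>f g. g \<in> continuous_functions X \<longrightarrow> stage_dist f g < d \<longrightarrow> g \<in> uniform_ball X C e f"
proof -
  obtain n where n: "C \<subseteq> K n" using cofinal_stages[OF assms(1)] by blast
  have "g \<in> uniform_ball X C e f"
    if "g \<in> continuous_functions X" "stage_dist f g < min e (1 / real (Suc n))" for f g
    unfolding uniform_ball_def
  proof (intro CollectI conjI ballI that(1))
    fix x assume "x \<in> C"
    then show "\<bar>g x - f x\<bar> < e"
      using diff_le_stage_dist[of f g n x] that(2) n by (auto simp: abs_minus_commute)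
  qed
  then show ?thesis using assms(2) by (intro exI[of _ "min e (1 / real (Suc n))"]) auto
qed

proposition Ck_eq_mtopology: "Metric_space.mtopology (continuous_functions X) stage_dist = Ck X"
proof -
  interpret C: Metric_space "continuous_functions X" stage_dist by (rule Metric_space_stage_dist)
  show ?thesis
    unfolding topology_eq
  proof
    fix U
    show "openin C.mtopology U = openin (Ck X) U"
      unfolding C.openin_mtopology openin_Ck
    proof (intro conj_cong refl iffI ballI allI impI)
      fix f assume U: "U \<subseteq> continuous_functions X" and f: "f \<in> U"
        and "\<forall>f. f \<in> U \<longrightarrow> (\<exists>r>0. C.mball f r \<subseteq> U)"
      then obtain r where r: "r > 0" "C.mball f r \<subseteq> U" by blast
      obtain n d where "d > 0" "\<forall>g\<in>uniform_ball X (K n) d f. stage_dist f g < r"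
        using uniform_ball_subset_stage_ball[of f r] f U r(1) by blast
      moreover from this have "uniform_ball X (K n) d f \<subseteq> C.mball f r"
        using f U by (auto simp: uniform_ball_def C.mball_def)
      ultimately show "\<exists>K e. compactin X K \<and> e > 0 \<and> uniform_ball X K e f \<subseteq> U"
        using compactin_stage r(2) by (meson order_trans)
    next
      fix f assume U: "U \<subseteq> continuous_functions X" and f: "f \<in> U"
        and "\<forall>f\<in>U. \<exists>K e. compactin X K \<and> e > 0 \<and> uniform_ball X K e f \<subseteq> U"
      then obtain C e where C: "compactin X C" "e > 0" "uniform_ball X C e f \<subseteq> U" by blast
      obtain d where "d > 0" "\<And>g. g \<in> continuous_functions X \<Longrightarrow> stage_dist f g < d \<Longrightarrow> g \<in> uniform_ball X C e f"
        using stage_ball_subset_uniform_ball[OF C(1,2)] by blast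
      then show "\<exists>r>0. C.mball f r \<subseteq> U"
        using C(3) by (intro exI[of _ d]) (auto simp: C.mball_def)
    qed
  qed
qed

end

section \<open>Function spaces, hemicompactness and the k-property\<close>

lemma tychonoff_space_separation:
  assumes "tychonoff_space X" "closedin X S" "x \<in> topspace X" "x \<notin> S"
  shows "\<exists>f\<in>continuous_functions X. f x = 1 \<and> (\<forall>y\<in>S. f y = 0) \<and> (\<forall>y. 0 \<le> f y \<and> f y \<le> 1)"
proof -
  obtain f where f: "continuous_map X (top_of_set {0..1::real}) f" "f x = 0" "f ` S \<subseteq> {1}"
    using assms unfolding tychonoff_space_def completely_regular_space_def by blast
  have 1: "continuous_map X euclideanreal (\<lambda>x. 1 - f x)" and 2: "\<And>y. y \<in> topspace X \<Longrightarrow> f y \<in> {0..1}"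
    using f(1) by (auto simp: continuous_map_in_subtopology intro!: continuous_map_diff)
  show ?thesis
    using zero_extension_continuous_functions[OF 1] f(2,3) 2 closedin_subset[OF assms(2)] assms(3)
    by (intro bexI[of _ "zero_extension X (\<lambda>x. 1 - f x)"]) (auto simp: zero_extension_def)
qed

text \<open>Density is needed at two points at a time only, so pointwise density suffices.\<close>

lemma dense_Cp_separates_points:
  assumes X: "tychonoff_space X" and T: "topspace T = continuous_functions X"
    "\<And>U. openin (Cp X) U \<Longrightarrow> openin T U"
    and D: "T closure_of D = topspace T" and xy: "x \<in> topspace X" "y \<in> topspace X" "x \<noteq> y"
  shows "\<exists>f\<in>D. f x \<noteq> f y"
proof -
  have "closedin X {y}"
    using X xy unfolding tychonoff_space_def by (simp add: closedin_Hausdorff_sing_eq)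
  then obtain f where f: "f \<in> continuous_functions X" "f x = 1" "f y = 0"
    using tychonoff_space_separation[OF X, of "{y}" x] xy by auto
  define U where "U = {g \<in> topspace (Cp X). g x \<in> {1/2<..}} \<inter> {g \<in> topspace (Cp X). g y \<in> {..<1/2}}"
  have "openin (Cp X) U"
    unfolding U_def by (intro openin_Int openin_real_preimage continuous_map_Cp_apply) auto
  then have "openin T U" by (rule T(2))
  moreover have "f \<in> U" using f by (simp add: U_def)
  moreover have "f \<in> T closure_of D" using D T(1) f(1) by simp
  ultimately obtain g where g: "g \<in> D" "g \<in> U" by (meson in_closure_of)
  then have "g x > 1/2" "g y < 1/2" unfolding U_def by simp_all
  then show ?thesis using g(1) by (intro bexI[of _ g]) auto
qed

text \<open>The sequence maps \<open>X\<close> continuously and injectively into the metric space of real sequences,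
  whose metric pulls back.\<close>

lemma separating_sequence_imp_submetrizable:
  fixes s :: "nat \<Rightarrow> 'a \<Rightarrow> real"
  assumes s: "\<And>n. continuous_map X euclideanreal (s n)"
    and sep: "\<And>x y. x \<in> topspace X \<Longrightarrow> y \<in> topspace X \<Longrightarrow> x \<noteq> y \<Longrightarrow> \<exists>n. s n x \<noteq> s n y"
  shows "submetrizable_space X"
proof -
  define e where "e x = (\<lambda>n. s n x)" for x
  have e: "continuous_map X euclidean e"
    using s unfolding e_def euclidean_product_topology[symmetric] by (simp add: continuous_map_componentwise_UNIV)
  have inj: "e x = e y \<longleftrightarrow> x = y" if "x \<in> topspace X" "y \<in> topspace X" for x y
    using sep[OF that] by (auto simp: e_def fun_eq_iff)
  have "Metric_space (topspace X) (\<lambda>x y. dist (e x) (e y))"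
    by unfold_locales (auto simp: inj dist_commute dist_triangle)
  moreover have "continuous_map (prod_topology X X) euclideanreal (\<lambda>p. mdist euclidean_metric (e (fst p)) (e (snd p)))"
    by (intro continuous_map_mdist)
      (use continuous_map_compose[OF continuous_map_fst e] continuous_map_compose[OF continuous_map_snd e]
        in \<open>simp_all add: o_def\<close>)
  then have "continuous_map (prod_topology X X) euclideanreal (\<lambda>(x, y). dist (e x) (e y))"
    by (simp add: case_prod_unfold)
  ultimately show ?thesis unfolding submetrizable_space_def by blast
qed

lemma separable_finer_than_Cp_imp_submetrizable:
  assumes X: "tychonoff_space X" and T: "topspace T = continuous_functions X"
    "\<And>U. openin (Cp X) U \<Longrightarrow> openin T U" and "separable_space T"
  shows "submetrizable_space X"
proof -
  obtain D where D: "countable D" "D \<subseteq> continuous_functions X" "T closure_of D = topspace T"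
    using assms(4) T(1) unfolding separable_space_def by blast
  have ne: "D \<noteq> {}"
    using D(3) T(1) continuous_functions_zero[of X] by auto
  show ?thesis
  proof (rule separating_sequence_imp_submetrizable)
    show "continuous_map X euclideanreal (from_nat_into D n)" for n
      using from_nat_into[OF ne, of n] D(2) continuous_functionsD(1) by blast
    show "\<exists>n. from_nat_into D n x \<noteq> from_nat_into D n y"
      if "x \<in> topspace X" "y \<in> topspace X" "x \<noteq> y" for x y
      using dense_Cp_separates_points[OF X T D(3) that] from_nat_into_surj[OF D(1)] by metis
  qed
qed

text \<open>A countable neighbourhood base at \<open>0\<close> yields countably many compact sets. If a compact set \<open>C\<close> were
  contained in none of them, a function vanishing on one of them but not on \<open>C\<close> would contradict
  that the corresponding neighbourhood controls the values on \<open>C\<close>.\<close>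

lemma metrizable_Ck_imp_hemicompact:
  assumes X: "tychonoff_space X" and m: "metrizable_space (Ck X)"
  shows "hemicompact_space X"
proof -
  have "first_countable (Ck X)" by (rule metrizable_imp_first_countable[OF m])
  then obtain \<B> where \<B>: "countable \<B>" "\<And>V. V \<in> \<B> \<Longrightarrow> openin (Ck X) V"
    "\<And>U. openin (Ck X) U \<Longrightarrow> 0 \<in> U \<Longrightarrow> \<exists>V\<in>\<B>. 0 \<in> V \<and> V \<subseteq> U"
    using continuous_functions_zero[of X] unfolding first_countable_def by (metis topspace_Ck)
  have "\<exists>K e. 0 \<in> V \<longrightarrow> compactin X K \<and> e > 0 \<and> uniform_ball X K e 0 \<subseteq> V" if "V \<in> \<B>" for V
    using \<B>(2)[OF that] unfolding openin_Ck by blast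
  then obtain K e where K: "\<And>V. V \<in> \<B> \<Longrightarrow> 0 \<in> V \<Longrightarrow>
      compactin X (K V) \<and> (0::real) < e V \<and> uniform_ball X (K V) (e V) 0 \<subseteq> V"
    by metis
  show ?thesis
    unfolding hemicompact_space_def
  proof (intro exI conjI ballI allI impI)
    show "countable (K ` {V\<in>\<B>. 0 \<in> V})" using \<B>(1) by simp
    show "compactin X C" if "C \<in> K ` {V\<in>\<B>. 0 \<in> V}" for C using that K by auto
    fix C assume C: "compactin X C"
    obtain O' where O': "openin (Ck X) O'" "0 \<in> O'" "O' \<subseteq> uniform_ball X C 1 0"
      using uniform_ball_contains_open[OF continuous_functions_zero C, of 1] by auto
    obtain V where V: "V \<in> \<B>" "0 \<in> V" "V \<subseteq> O'" using \<B>(3)[OF O'(1,2)] by blast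
    have "C \<subseteq> K V"
    proof (rule ccontr)
      assume "\<not> C \<subseteq> K V"
      then obtain x where x: "x \<in> C" "x \<notin> K V" by blast
      have "closedin X (K V)"
        using K[OF V(1,2)] X by (simp add: compactin_imp_closedin tychonoff_space_def)
      then obtain f where f: "f \<in> continuous_functions X" "f x = 1" "\<forall>y\<in>K V. f y = 0"
        using tychonoff_space_separation[OF X _ _ x(2)] x(1) compactin_subset_topspace[OF C] by blast
      then have "f \<in> uniform_ball X (K V) (e V) 0"
        using K[OF V(1,2)] by (simp add: uniform_ball_def)
      then have "f \<in> uniform_ball X C 1 0" using K[OF V(1,2)] V(3) O'(3) by blast
      then show False using x(1) f(2) by (force simp: uniform_ball_def)
    qed
    then show "\<exists>D\<in>K ` {V\<in>\<B>. 0 \<in> V}. C \<subseteq> D" using V by blast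
  qed
qed

lemma k_spaceD:
  assumes "k_space X" "S \<subseteq> topspace X"
    and "\<And>C. compactin X C \<Longrightarrow> closedin (subtopology X C) (C \<inter> S)"
  shows "closedin X S"
  using assms unfolding k_space_def by blast

context compact_exhaustion
begin

lemma extend_from_stage:
  assumes "completely_regular_space X" "f \<in> stagewise_continuous"
  shows "\<exists>g\<in>continuous_functions X. \<forall>x\<in>K n. g x = f x"
proof -
  have "continuous_map (subtopology X (K n)) euclideanreal f"
    using assms(2) by (simp add: stagewise_continuous_def)
  then obtain g where g: "continuous_map X euclideanreal g" "\<And>x. x \<in> K n \<Longrightarrow> g x = f x"
    using Tietze_extension_completely_regular[OF assms(1) compactin_stage is_interval_univ]
    by (metis UNIV_not_empty subset_UNIV)
  then show ?thesis
    using stage_subset[of n] zero_extension_continuous_functions[OF g(1)]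
    by (intro bexI[of _ "zero_extension X g"]) auto
qed

lemma continuous_functions_dense:
  assumes "completely_regular_space X" "f \<in> stagewise_continuous" "e > 0"
  shows "\<exists>g\<in>continuous_functions X. stage_dist f g < e"
proof -
  obtain n where n: "1 / real (Suc n) < e" using nat_approx_posE assms(3) by blast
  obtain g where g: "g \<in> continuous_functions X" "\<forall>x\<in>K n. g x = f x"
    using extend_from_stage[OF assms(1,2)] by blast
  have "stage_dist f g \<le> 1 / real (Suc n)"
    using g assms(2) by (intro stage_dist_leI[of _ _ n])
      (auto simp: continuous_functions_def stagewise_continuous_def)
  then show ?thesis using g(1) n by force
qed

text \<open>The continuous functions, being completely metrizable, form a dense \<open>G\<^sub>\<delta>\<close> subset of the
  complete space of stagewise continuous functions. A proper dense subgroup of a complete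
  metric group cannot be a \<open>G\<^sub>\<delta>\<close> subset, since by Baire's theorem it would meet its cosets.\<close>

proposition completely_metrizable_Ck_imp_stagewise:
  assumes X: "completely_regular_space X" and cm: "completely_metrizable_space (Ck X)"
  shows "stagewise_continuous \<subseteq> continuous_functions X"
proof (rule ccontr)
  assume "\<not> stagewise_continuous \<subseteq> continuous_functions X"
  then obtain f where f: "f \<in> stagewise_continuous" "f \<notin> continuous_functions X" by blast
  interpret Z: Metric_space stagewise_continuous stage_dist by (rule Metric_space_stage_dist)
  interpret C: Submetric stagewise_continuous stage_dist "continuous_functions X"
    by unfold_locales (rule continuous_functions_stagewise)
  have "completely_metrizable_space Z.mtopology"
    by (rule Z.completely_metrizable_space_mtopology[OF mcomplete_stagewise])
  moreover have "completely_metrizable_space (subtopology Z.mtopology (continuous_functions X))"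
    using cm C.mtopology_submetric Ck_eq_mtopology by simp
  ultimately have "gdelta_in Z.mtopology (continuous_functions X)"
    using completely_metrizable_space_eq_gdelta_in[of Z.mtopology "continuous_functions X"]
      continuous_functions_stagewise by simp
  then obtain \<G> where \<G>: "countable \<G>" "\<And>G. G \<in> \<G> \<Longrightarrow> openin Z.mtopology G" "\<Inter>\<G> = continuous_functions X"
    unfolding gdelta_in_alt intersection_of_def by blast
  \<comment> \<open>translates of the open sets whose intersection is the subgroup; they intersect in the coset of \<open>f\<close>\<close>
  define shift where "shift G = {h \<in> stagewise_continuous. h - f \<in> G}" for G
  have op: "openin Z.mtopology (shift G)" if G: "openin Z.mtopology G" for G
    unfolding Z.openin_mtopology
  proof (intro conjI allI impI)
    fix h assume h: "h \<in> shift G"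
    then obtain r where r: "r > 0" "Z.mball (h - f) r \<subseteq> G"
      using G unfolding Z.openin_mtopology shift_def by blast
    have "g \<in> shift G" if "g \<in> Z.mball h r" for g
    proof -
      have "stage_dist (h - f) (g - f) = stage_dist h g"
        using stage_dist_translate[of h "-f" g] by simp
      then have "g - f \<in> Z.mball (h - f) r"
        using that h f(1) by (auto simp: Z.mball_def shift_def stagewise_continuous_diff)
      then show ?thesis using r(2) that by (auto simp: shift_def)
    qed
    then show "\<exists>r>0. Z.mball h r \<subseteq> shift G" using r(1) by blast
  qed (auto simp: shift_def)
  have dense: "Z.mtopology closure_of G = stagewise_continuous" if "G \<in> \<G>" for G
  proof -
    have "continuous_functions X \<subseteq> G" using \<G>(3) that by blast
    then show ?thesis
      unfolding Z.metric_closure_of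
      using continuous_functions_dense[OF X] continuous_functions_stagewise
      by (fastforce simp: Z.mball_def)
  qed
  have dense': "Z.mtopology closure_of shift G = stagewise_continuous" if "G \<in> \<G>" for G
  proof -
    have CG: "continuous_functions X \<subseteq> G" using \<G>(3) that by blast
    have "\<exists>y\<in>shift G. y \<in> Z.mball h r" if h: "h \<in> stagewise_continuous" and r: "r > 0" for h r
    proof -
      obtain g where g: "g \<in> continuous_functions X" "stage_dist (h - f) g < r"
        using continuous_functions_dense[OF X stagewise_continuous_diff[OF h f(1)] r] by blast
      have "stage_dist h (g + f) = stage_dist (h - f) g"
        using stage_dist_translate[of "h - f" f g] by simp
      moreover have "g + f \<in> stagewise_continuous"
        using g(1) f(1) continuous_functions_stagewise stagewise_continuous_add by blast
      ultimately show ?thesis using g CG h by (intro bexI[of _ "g + f"]) (auto simp: shift_def)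
    qed
    then show ?thesis unfolding Z.metric_closure_of by blast
  qed
  have "Z.mtopology closure_of \<Inter>(\<G> \<union> shift ` \<G>) = stagewise_continuous"
    using \<G>(1,2) op dense dense' by (intro Z.metric_Baire_category[OF mcomplete_stagewise]) auto
  then have "\<Inter>(\<G> \<union> shift ` \<G>) \<noteq> {}" using f(1) by fastforce
  then obtain h where h: "\<And>G. G \<in> \<G> \<Longrightarrow> h \<in> G" "\<And>G. G \<in> \<G> \<Longrightarrow> h - f \<in> G"
    by (auto simp: shift_def)
  then have "h \<in> continuous_functions X" "h - f \<in> continuous_functions X"
    using \<G>(3) by blast+
  then have "h - (h - f) \<in> continuous_functions X" by (rule continuous_functions_diff)
  then show False using f(2) by simp
qed

text \<open>The function need not be continuous on \<open>X\<close>, so it can be built one stage at a time: the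
  values on a stage, and \<open>0\<close> on the part of \<open>S\<close> in the next one, are prescribed on a closed subset of
  the next stage, which is normal, and Tietze's theorem extends them.\<close>

lemma stagewise_separation:
  assumes H: "Hausdorff_space X"
    and S: "\<And>C. compactin X C \<Longrightarrow> closedin (subtopology X C) (C \<inter> S)"
    and x: "x \<in> topspace X" "x \<notin> S"
  shows "\<exists>f\<in>stagewise_continuous. f x = 1 \<and> (\<forall>y\<in>S. f y = 0)"
proof -
  obtain n0 where n0: "x \<in> K n0" using stages_cover[OF x(1)] by blast
  \<comment> \<open>starting with a stage that contains \<open>x\<close>, so that the value at \<open>x\<close> is fixed once and for all\<close>
  define L where "L n = K (n0 + n)" for n
  have cL: "compactin X (L n)" for n unfolding L_def by (rule compactin_stage)
  have LS: "L n \<subseteq> L (Suc n)" for n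
    unfolding L_def using incseq_stages by (simp add: incseqD)
  have Lmono: "L m \<subseteq> L n" if "m \<le> n" for m n
    unfolding L_def using incseq_stages that by (simp add: incseqD)
  have normal: "normal_space (subtopology X (L n))" for n
    using cL[of n] H by (intro compact_Hausdorff_or_regular_imp_normal_space)
      (auto simp: compact_space_subtopology Hausdorff_space_subtopology)
  have top: "topspace (subtopology X (L n)) = L n" for n
    using compactin_subset_topspace[OF cL] by auto
  define P where "P n F \<longleftrightarrow> continuous_map (subtopology X (L n)) euclideanreal F \<and>
      (\<forall>y\<in>L n \<inter> S. F y = 0) \<and> F x = 1" for n and F :: "'a \<Rightarrow> real"
  have "\<exists>F. \<forall>n. P n (F n) \<and> (\<forall>y\<in>L n. F (Suc n) y = F n y)"
  proof (rule dependent_nat_choice)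
    have "closedin (subtopology X (L 0)) {x}"
      using H n0 x(1) by (simp add: L_def closedin_Hausdorff_sing_eq Hausdorff_space_subtopology)
    then obtain F where "continuous_map (subtopology X (L 0)) euclideanreal F"
       "F ` (L 0 \<inter> S) \<subseteq> {0}" "F ` {x} \<subseteq> {1}"
      using Urysohn_lemma_alt[OF normal S[OF cL], of 0 "{x}" 0 1] x(2) by (auto simp: disjnt_def)
    then show "\<exists>F. P 0 F" unfolding P_def by auto
  next
    fix F n assume F: "P n F"
    let ?Y = "subtopology X (L (Suc n))"
    define T where "T = L n \<union> (L (Suc n) \<inter> S)"
    define h where "h y = (if y \<in> L n then F y else 0)" for y
    have clL: "closedin ?Y (L n)"
      using compactin_imp_closedin[OF H cL[of n]] LS[of n] by (simp add: closedin_subset_topspace)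
    have clS: "closedin ?Y (L (Suc n) \<inter> S)" by (rule S[OF cL])
    have TL: "T \<subseteq> L (Suc n)" unfolding T_def using LS[of n] by blast
    have sub: "subtopology ?Y T = subtopology X T"
      using TL by (simp add: subtopology_subtopology inf.absorb2)
    have "continuous_map (subtopology X T) euclideanreal h"
    proof (rule pasting_lemma_closed[where I = "{True, False}" and T = "\<lambda>b. if b then L n else L (Suc n) \<inter> S"
            and f = "\<lambda>b. if b then F else (\<lambda>_. 0)"])
      fix b assume "b \<in> {True, False}"
      show "closedin (subtopology X T) (if b then L n else L (Suc n) \<inter> S)"
        unfolding sub[symmetric] using clL clS by (auto simp: T_def intro: closedin_subset_topspace)
      have "subtopology (subtopology X T) (L n) = subtopology X (L n)"
        by (simp add: subtopology_subtopology T_def Int_absorb1)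
      then show "continuous_map (subtopology (subtopology X T) (if b then L n else L (Suc n) \<inter> S)) euclideanreal
          (if b then F else (\<lambda>_. 0))"
        using F by (simp add: P_def)
    next
      fix i j y assume "i \<in> {True, False}" "j \<in> {True, False}"
        "y \<in> topspace (subtopology X T) \<inter> (if i then L n else L (Suc n) \<inter> S) \<inter> (if j then L n else L (Suc n) \<inter> S)"
      then show "(if i then F else (\<lambda>_. 0)) y = (if j then F else (\<lambda>_. 0)) y"
        using F by (auto simp: P_def split: if_splits)
    next
      fix y assume "y \<in> topspace (subtopology X T)"
      then show "\<exists>j. j \<in> {True, False} \<and> y \<in> (if j then L n else L (Suc n) \<inter> S) \<and> h y = (if j then F else (\<lambda>_. 0)) y"
        unfolding T_def h_def by (cases "y \<in> L n") auto
    qed simp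
    moreover have "closedin ?Y T" unfolding T_def using clL clS by (rule closedin_Un)
    ultimately obtain G where G: "continuous_map ?Y euclideanreal G" "\<And>y. y \<in> T \<Longrightarrow> G y = h y"
      using Tietze_extension_realinterval[OF normal, of "Suc n" T UNIV h] sub by auto
    have "G y = 0" if "y \<in> L (Suc n) \<inter> S" for y
      using that G(2)[of y] F by (auto simp: T_def h_def P_def)
    moreover have "x \<in> L n" unfolding L_def using n0 incseq_stages by (meson incseqD le_add1 subsetD)
    then have "G x = 1" using G(2)[of x] F by (auto simp: T_def h_def P_def)
    moreover have "G y = F y" if "y \<in> L n" for y using that G(2)[of y] by (simp add: T_def h_def)
    ultimately show "\<exists>G. P (Suc n) G \<and> (\<forall>y\<in>L n. G y = F y)"
      using G(1) unfolding P_def by blast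
  qed
  then obtain F where F: "\<And>n. P n (F n)" and step: "\<And>n y. y \<in> L n \<Longrightarrow> F (Suc n) y = F n y" by blast
  have coh: "F n y = F m y" if "y \<in> L m" "m \<le> n" for m n y
    using that(2)
  proof (induction n rule: dec_induct)
    case (step n)
    then show ?case using \<open>\<And>n y. y \<in> L n \<Longrightarrow> F (Suc n) y = F n y\<close>[of y n] Lmono[of m n] that(1) by auto
  qed simp
  define f where "f = zero_extension X (\<lambda>y. F (LEAST n. y \<in> L n) y)"
  have fF: "f y = F n y" if "y \<in> L n" for n y
  proof -
    have "y \<in> L (LEAST n. y \<in> L n)" "(LEAST n. y \<in> L n) \<le> n"
      using that by (auto intro: LeastI Least_le)
    then show ?thesis using coh[of y "LEAST n. y \<in> L n" n] that compactin_subset_topspace[OF cL[of n]]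
      by (auto simp: f_def)
  qed
  have "continuous_map (subtopology X (K n)) euclideanreal f" for n
  proof -
    have "continuous_map (subtopology X (L n)) euclideanreal f"
      using F[of n] fF top unfolding P_def by (metis (no_types, lifting) continuous_map_eq)
    moreover have "K n \<subseteq> L n" unfolding L_def using incseq_stages by (simp add: incseqD)
    ultimately show ?thesis by (rule continuous_map_from_subtopology_mono)
  qed
  then have "f \<in> stagewise_continuous" by (simp add: stagewise_continuous_def f_def)
  moreover have "f x = 1" using fF[of x 0] n0 F[of 0] by (simp add: L_def P_def)
  moreover have "f y = 0" if "y \<in> S" for y
  proof (cases "y \<in> topspace X")
    case True
    then obtain m where "y \<in> K m" using stages_cover by blast
    then have "y \<in> L m" unfolding L_def using incseq_stages by (meson incseqD le_add2 subsetD)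
    then show ?thesis using fF[of y m] F[of m] that by (simp add: P_def)
  qed (simp add: f_def)
  ultimately show ?thesis by blast
qed

text \<open>A set that is closed in each compact set is separated from each point outside it by a
  stagewise continuous function. Once these functions are continuous, the set is closed.\<close>

proposition stagewise_imp_k_space:
  assumes H: "Hausdorff_space X" and Z: "stagewise_continuous \<subseteq> continuous_functions X"
  shows "k_space X"
  unfolding k_space_def
proof (intro allI impI iffI)
  fix S C assume "closedin X S" "compactin X C"
  then show "closedin (subtopology X C) (C \<inter> S)"
    by (simp add: closedin_subtopology_Int_closed)
next
  fix S assume S: "S \<subseteq> topspace X" and cl: "\<forall>C. compactin X C \<longrightarrow> closedin (subtopology X C) (C \<inter> S)"
  have "\<exists>U. openin X U \<and> x \<in> U \<and> U \<subseteq> topspace X - S" if x: "x \<in> topspace X - S" for x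
  proof -
    obtain f where f: "f \<in> continuous_functions X" "f x = 1" "\<forall>y\<in>S. f y = 0"
      using stagewise_separation[OF H, of S x] cl x Z by blast
    then show ?thesis using x openin_real_preimage[OF continuous_functionsD(1)[OF f(1)], of "-{0}"]
      by (intro exI[of _ "{x \<in> topspace X. f x \<in> -{0}}"]) auto
  qed
  then have "openin X (topspace X - S)" by (subst openin_subopen) blast
  then show "closedin X S" using S by (simp add: closedin_def)
qed

proposition k_space_imp_stagewise:
  assumes "k_space X"
  shows "stagewise_continuous = continuous_functions X"
proof
  show "stagewise_continuous \<subseteq> continuous_functions X"
  proof
    fix f assume f: "f \<in> stagewise_continuous"
    have cl: "closedin X {x \<in> topspace X. f x \<in> A}" if A: "closed A" for A
    proof -
      let ?S = "{x \<in> topspace X. f x \<in> A}"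
      have *: "closedin (subtopology X C) (C \<inter> ?S)" if C: "compactin X C" for C
      proof -
        obtain n where n: "C \<subseteq> K n" using cofinal_stages[OF C] by blast
        have "continuous_map (subtopology X (K n)) euclideanreal f"
          using f by (simp add: stagewise_continuous_def)
        then have "continuous_map (subtopology X C) euclideanreal f"
          using n by (rule continuous_map_from_subtopology_mono)
        then have "closedin (subtopology X C) {x \<in> topspace (subtopology X C). f x \<in> A}"
          using A by (rule closedin_real_preimage)
        moreover have "{x \<in> topspace (subtopology X C). f x \<in> A} = C \<inter> {x \<in> topspace X. f x \<in> A}"
          by auto
        ultimately show ?thesis by simp
      qed
      have "?S \<subseteq> topspace X" by blast
      then show ?thesis using * by (rule k_spaceD[OF assms])
    qed
    have "continuous_map X euclideanreal f"
      unfolding continuous_map_closedin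
    proof (intro conjI allI impI)
      fix A :: "real set" assume "closedin euclideanreal A"
      then have "closed A" by (simp only: closed_closedin)
      then show "closedin X {x \<in> topspace X. f x \<in> A}" by (rule cl)
    qed simp
    then show "f \<in> continuous_functions X"
      using f by (simp add: stagewise_continuous_def continuous_functions_def)
  qed
qed (rule continuous_functions_stagewise)

end

section \<open>Separability and the Frechet structure\<close>

text \<open>The distance of a member from \<open>f\<close> on the compact set is attained and so stays strictly below
  \<open>e\<close>, which leaves room for a ball around it.\<close>

lemma openin_uniform_ball:
  assumes f: "f \<in> continuous_functions X" and K: "compactin X K"
  shows "openin (Ck X) (uniform_ball X K e f)"
  unfolding openin_Ck
proof (intro conjI ballI)
  fix g assume g: "g \<in> uniform_ball X K e f"
  have gC: "g \<in> continuous_functions X" using g by (simp add: uniform_ball_def)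
  have "compact ((\<lambda>x. \<bar>g x - f x\<bar>) ` K)"
    using image_compactin[OF K continuous_real_compose[OF continuous_functionsD(1)[OF continuous_functions_diff[OF gC f]],
        of abs]] by (simp add: continuous_on_rabs)
  then obtain M where M: "M < e" "\<And>x. x \<in> K \<Longrightarrow> \<bar>g x - f x\<bar> \<le> M"
  proof (cases "K = {}")
    case True
    then show ?thesis using that[of "e - 1"] by simp
  next
    case False
    assume "compact ((\<lambda>x. \<bar>g x - f x\<bar>) ` K)"
    then obtain x where "x \<in> K" "\<And>y. y \<in> K \<Longrightarrow> \<bar>g y - f y\<bar> \<le> \<bar>g x - f x\<bar>"
      using compact_attains_sup[of "(\<lambda>x. \<bar>g x - f x\<bar>) ` K"] False by auto
    then show ?thesis using that[of "\<bar>g x - f x\<bar>"] g by (simp add: uniform_ball_def)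
  qed
  have "\<bar>h x - f x\<bar> < e" if h: "h \<in> uniform_ball X K (e - M) g" and x: "x \<in> K" for h x
  proof -
    have "\<bar>h x - g x\<bar> < e - M" using h x by (simp add: uniform_ball_def)
    then show ?thesis using M(2)[OF x] by linarith
  qed
  then have "uniform_ball X K (e - M) g \<subseteq> uniform_ball X K e f" by (auto simp: uniform_ball_def)
  then show "\<exists>K' e'. compactin X K' \<and> e' > 0 \<and> uniform_ball X K' e' g \<subseteq> uniform_ball X K e f"
    using K M(1) by (intro exI[of _ K] exI[of _ "e - M"]) simp
qed (auto simp: uniform_ball_def)

lemma continuous_map_into_Ck:
  assumes g: "\<And>z. z \<in> topspace Z \<Longrightarrow> g z \<in> continuous_functions X"
    and close: "\<And>z K e. z \<in> topspace Z \<Longrightarrow> compactin X K \<Longrightarrow> e > 0 \<Longrightarrow>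
      \<exists>U. openin Z U \<and> z \<in> U \<and> (\<forall>w\<in>U. \<forall>x\<in>K. \<bar>g w x - g z x\<bar> < e)"
  shows "continuous_map Z (Ck X) g"
  unfolding continuous_map_def
proof (intro conjI allI impI)
  show "g \<in> topspace Z \<rightarrow> topspace (Ck X)" using g by auto
  fix U assume U: "openin (Ck X) U"
  have "\<exists>T. openin Z T \<and> z \<in> T \<and> T \<subseteq> {z \<in> topspace Z. g z \<in> U}" if z: "z \<in> topspace Z" "g z \<in> U" for z
  proof -
    obtain K e where K: "compactin X K" "e > 0" "uniform_ball X K e (g z) \<subseteq> U"
      using U z(2) unfolding openin_Ck by blast
    obtain T where T: "openin Z T" "z \<in> T" "\<forall>w\<in>T. \<forall>x\<in>K. \<bar>g w x - g z x\<bar> < e"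
      using close[OF z(1) K(1,2)] by blast
    then have "T \<subseteq> {z \<in> topspace Z. g z \<in> U}"
      using K(3) g openin_subset[OF T(1)] by (auto simp: uniform_ball_def subset_iff)
    then show ?thesis using T by blast
  qed
  then show "openin Z {z \<in> topspace Z. g z \<in> U}" by (subst openin_subopen) blast
qed

proposition locally_convex_space_Ck: "locally_convex_space (Ck X)"
  unfolding locally_convex_space_def topological_vector_space_def
proof (intro conjI allI impI)
  show "subspace (topspace (Ck X))" by (simp add: subspace_continuous_functions)
  show "continuous_map (prod_topology (Ck X) (Ck X)) (Ck X) (\<lambda>(f, g). f + g)"
  proof (rule continuous_map_into_Ck)
    fix p K and e :: real
    assume p: "p \<in> topspace (prod_topology (Ck X) (Ck X))" and K: "compactin X K" and e: "e > 0"
    obtain f g where fg: "p = (f, g)" "f \<in> continuous_functions X" "g \<in> continuous_functions X"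
      using p by auto
    let ?U = "uniform_ball X K (e/2) f \<times> uniform_ball X K (e/2) g"
    have "openin (prod_topology (Ck X) (Ck X)) ?U"
      using openin_uniform_ball[OF _ K] fg by (simp add: openin_prod_Times_iff)
    moreover have "p \<in> ?U" using fg e by (simp add: uniform_ball_def)
    moreover have "\<bar>(case w of (f, g) \<Rightarrow> f + g) x - (case p of (f, g) \<Rightarrow> f + g) x\<bar> < e"
      if "w \<in> ?U" "x \<in> K" for w x
    proof -
      obtain h k where w: "w = (h, k)" by fastforce
      have "\<bar>h x - f x\<bar> < e/2" "\<bar>k x - g x\<bar> < e/2"
        using that by (auto simp: w uniform_ball_def)
      moreover have "(case w of (f, g) \<Rightarrow> f + g) x - (case p of (f, g) \<Rightarrow> f + g) x = (h x - f x) + (k x - g x)"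
        by (simp add: w fg)
      ultimately show ?thesis by linarith
    qed
    ultimately show "\<exists>U. openin (prod_topology (Ck X) (Ck X)) U \<and> p \<in> U \<and>
       (\<forall>w\<in>U. \<forall>x\<in>K. \<bar>(case w of (f, g) \<Rightarrow> f + g) x - (case p of (f, g) \<Rightarrow> f + g) x\<bar> < e)" by blast
  qed (auto intro: continuous_functions_add)
  show "continuous_map (prod_topology euclideanreal (Ck X)) (Ck X) (\<lambda>(c, f). c *\<^sub>R f)"
  proof (rule continuous_map_into_Ck)
    fix p K and e :: real
    assume p: "p \<in> topspace (prod_topology euclideanreal (Ck X))" and K: "compactin X K" and e: "e > 0"
    obtain c f where cf: "p = (c, f)" "f \<in> continuous_functions X"
      using p by auto
    obtain M0 where M0: "\<forall>x\<in>K. \<bar>f x\<bar> \<le> M0" using bounded_on_compactin[OF cf(2) K] by blast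
    define M where "M = \<bar>M0\<bar> + 1"
    have M: "M > 0" "\<And>x. x \<in> K \<Longrightarrow> \<bar>f x\<bar> \<le> M" using M0 by (force simp: M_def)+
    define d where "d = min 1 (e / (2 * M))"
    define d' where "d' = e / (2 * (\<bar>c\<bar> + 1))"
    have d: "d > 0" "d \<le> 1" "d * M \<le> e/2" and d': "d' > 0" "(\<bar>c\<bar> + 1) * d' = e/2"
      using e M(1) by (auto simp: d_def d'_def field_simps min_def)
    let ?U = "ball c d \<times> uniform_ball X K d' f"
    have "openin (prod_topology euclideanreal (Ck X)) ?U"
      using openin_uniform_ball[OF cf(2) K] by (simp add: openin_prod_Times_iff)
    moreover have "p \<in> ?U" using cf d d' by (simp add: uniform_ball_def)
    moreover have "\<bar>(case w of (c, f) \<Rightarrow> c *\<^sub>R f) x - (case p of (c, f) \<Rightarrow> c *\<^sub>R f) x\<bar> < e"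
      if w: "w \<in> ?U" and x: "x \<in> K" for w x
    proof -
      obtain b h where bh: "w = (b, h)" by fastforce
      have 1: "\<bar>b - c\<bar> < d" and 2: "\<bar>h x - f x\<bar> < d'"
        using w x by (auto simp: bh uniform_ball_def dist_real_def)
      have b: "\<bar>b\<bar> \<le> \<bar>c\<bar> + 1" using 1 d(2) by linarith
      have "\<bar>b * h x - c * f x\<bar> = \<bar>b * (h x - f x) + (b - c) * f x\<bar>" by (simp add: algebra_simps)
      also have "\<dots> \<le> \<bar>b\<bar> * \<bar>h x - f x\<bar> + \<bar>b - c\<bar> * \<bar>f x\<bar>"
        by (metis abs_mult abs_triangle_ineq)
      also have "\<dots> \<le> (\<bar>c\<bar> + 1) * \<bar>h x - f x\<bar> + d * M"
        using b 1 M x by (intro add_mono mult_mono) auto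
      also have "\<dots> < (\<bar>c\<bar> + 1) * d' + d * M"
        using 2 by (intro add_strict_right_mono mult_strict_left_mono) auto
      also have "\<dots> \<le> e" using d(3) d'(2) by linarith
      finally show ?thesis by (simp add: bh cf)
    qed
    ultimately show "\<exists>U. openin (prod_topology euclideanreal (Ck X)) U \<and> p \<in> U \<and>
       (\<forall>w\<in>U. \<forall>x\<in>K. \<bar>(case w of (c, f) \<Rightarrow> c *\<^sub>R f) x - (case p of (c, f) \<Rightarrow> c *\<^sub>R f) x\<bar> < e)" by blast
  qed (auto intro: continuous_functions_scale)
  fix U assume "openin (Ck X) U \<and> 0 \<in> U"
  then obtain K e where K: "compactin X K" "e > 0" "uniform_ball X K e 0 \<subseteq> U"
    unfolding openin_Ck by blast
  have "convex (uniform_ball X K e 0)"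
  proof (rule convexI)
    fix f g and u v :: real
    assume fg: "f \<in> uniform_ball X K e 0" "g \<in> uniform_ball X K e 0" and uv: "0 \<le> u" "0 \<le> v" "u + v = 1"
    have "\<bar>u * f x + v * g x\<bar> < e" if "x \<in> K" for x
    proof -
      have "f x \<in> {-e<..<e}" "g x \<in> {-e<..<e}" using fg that by (auto simp: uniform_ball_def abs_less_iff)
      then have "u *\<^sub>R f x + v *\<^sub>R g x \<in> {-e<..<e}" using uv by (intro convexD) auto
      then show ?thesis by (auto simp: abs_less_iff)
    qed
    then show "u *\<^sub>R f + v *\<^sub>R g \<in> uniform_ball X K e 0"
      using fg by (auto simp: uniform_ball_def intro!: continuous_functions_add continuous_functions_scale)
  qed
  then show "\<exists>V. openin (Ck X) V \<and> convex V \<and> 0 \<in> V \<and> V \<subseteq> U"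
    using K openin_uniform_ball[OF continuous_functions_zero K(1)] continuous_functions_zero
    by (intro exI[of _ "uniform_ball X K e 0"]) (auto simp: uniform_ball_def)
qed

text \<open>Rational polynomials in countably many variables: a countable set of functions that is
  uniformly dense on every compact set of real sequences.\<close>

datatype rational_polynomial = Const rat | Coord nat
  | Plus rational_polynomial rational_polynomial | Times rational_polynomial rational_polynomial

instance rational_polynomial :: countable
  by countable_datatype

primrec evaluate :: "rational_polynomial \<Rightarrow> (nat \<Rightarrow> real) \<Rightarrow> real" where
  "evaluate (Const r) x = of_rat r"
| "evaluate (Coord n) x = x n"
| "evaluate (Plus p q) x = evaluate p x + evaluate q x"
| "evaluate (Times p q) x = evaluate p x * evaluate q x"

lemma continuous_on_evaluate: "continuous_on S (evaluate p)"
proof (induction p)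
  case (Coord n)
  then show ?case
    using continuous_on_subset[OF continuous_on_product_coordinates[of n] subset_UNIV] by simp
qed (auto intro!: continuous_intros)

definition approximable :: "(nat \<Rightarrow> real) set \<Rightarrow> ((nat \<Rightarrow> real) \<Rightarrow> real) \<Rightarrow> bool" where
  "approximable S g \<longleftrightarrow> continuous_on S g \<and> (\<forall>e>0. \<exists>p. \<forall>x\<in>S. \<bar>g x - evaluate p x\<bar> < e)"

lemma approximable_add:
  assumes "approximable S f" "approximable S g"
  shows "approximable S (\<lambda>x. f x + g x)"
  unfolding approximable_def
proof (intro conjI allI impI)
  show "continuous_on S (\<lambda>x. f x + g x)"
    using assms by (auto simp: approximable_def intro: continuous_on_add)
  fix e :: real assume "e > 0"
  then obtain p q where "\<forall>x\<in>S. \<bar>f x - evaluate p x\<bar> < e/2" "\<forall>x\<in>S. \<bar>g x - evaluate q x\<bar> < e/2"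
    using assms unfolding approximable_def by (meson half_gt_zero)
  then show "\<exists>p. \<forall>x\<in>S. \<bar>f x + g x - evaluate p x\<bar> < e"
    by (intro exI[of _ "Plus p q"]) (force simp: abs_if split: if_splits)
qed

lemma approximable_mult:
  assumes S: "compact S" and f: "approximable S f" and g: "approximable S g"
  shows "approximable S (\<lambda>x. f x * g x)"
  unfolding approximable_def
proof (intro conjI allI impI)
  show "continuous_on S (\<lambda>x. f x * g x)"
    using f g by (auto simp: approximable_def intro: continuous_on_mult)
  fix e :: real assume e: "e > 0"
  have bnd: "\<exists>B. \<forall>x\<in>S. \<bar>k x\<bar> \<le> B" if "approximable S k" for k
    using compact_imp_bounded[OF compact_continuous_image[OF _ S], of k] that
    by (auto simp: approximable_def bounded_real)
  obtain M1 M2 where M12: "\<And>x. x \<in> S \<Longrightarrow> \<bar>f x\<bar> \<le> M1" "\<And>x. x \<in> S \<Longrightarrow> \<bar>g x\<bar> \<le> M2"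
    using bnd[OF f] bnd[OF g] by blast
  define M where "M = \<bar>M1\<bar> + \<bar>M2\<bar> + 1"
  have M: "M \<ge> 1" "\<And>x. x \<in> S \<Longrightarrow> \<bar>f x\<bar> \<le> M" "\<And>x. x \<in> S \<Longrightarrow> \<bar>g x\<bar> \<le> M"
    using M12 by (force simp: M_def)+
  define d where "d = min 1 (e / (4 * M))"
  have d: "d > 0" "d \<le> 1" "d * M \<le> e/4"
    using e M(1) by (auto simp: d_def min_def field_simps)
  obtain p q where p: "\<And>x. x \<in> S \<Longrightarrow> \<bar>f x - evaluate p x\<bar> < d"
    and q: "\<And>x. x \<in> S \<Longrightarrow> \<bar>g x - evaluate q x\<bar> < d"
    using f g d(1) unfolding approximable_def by meson
  have "\<bar>f x * g x - evaluate p x * evaluate q x\<bar> < e" if x: "x \<in> S" for x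
  proof -
    have ep: "\<bar>evaluate p x\<bar> \<le> 2 * M" using p[OF x] M(1) M(2)[OF x] d(2) by linarith
    have "\<bar>f x * g x - evaluate p x * evaluate q x\<bar>
      = \<bar>(f x - evaluate p x) * g x + evaluate p x * (g x - evaluate q x)\<bar>"
      by (simp add: algebra_simps)
    also have "\<dots> \<le> \<bar>f x - evaluate p x\<bar> * \<bar>g x\<bar> + \<bar>evaluate p x\<bar> * \<bar>g x - evaluate q x\<bar>"
      by (metis abs_mult abs_triangle_ineq)
    also have "\<dots> \<le> d * M + (2 * M) * d"
      using p[OF x] q[OF x] M(1) M(3)[OF x] ep d(1) by (intro add_mono mult_mono) auto
    also have "\<dots> < e" using d(3) e by (simp add: mult.commute)
    finally show ?thesis .
  qed
  then show "\<exists>p. \<forall>x\<in>S. \<bar>f x * g x - evaluate p x\<bar> < e"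
    by (intro exI[of _ "Times p q"]) simp
qed

lemma continuous_imp_approximable:
  assumes S: "compact S" and h: "continuous_on S h"
  shows "approximable S h"
  unfolding approximable_def
proof (intro conjI allI impI h)
  fix e :: real assume e: "e > 0"
  have "\<exists>g. approximable S g \<and> (\<forall>x\<in>S. \<bar>h x - g x\<bar> < e/2)"
  proof (rule Stone_Weierstrass_HOL[OF S])
    fix c :: real
    show "approximable S (\<lambda>x. c)"
      unfolding approximable_def
    proof (intro conjI allI impI)
      fix e :: real assume "e > 0"
      then obtain r where "c - e < of_rat r" "of_rat r < c + e" using of_rat_dense[of "c - e" "c + e"] by auto
      then show "\<exists>p. \<forall>x\<in>S. \<bar>c - evaluate p x\<bar> < e"
        by (intro exI[of _ "Const r"]) auto
    qed simp
  next
    fix x y :: "nat \<Rightarrow> real" assume "x \<in> S \<and> y \<in> S \<and> x \<noteq> y"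
    then obtain n where n: "x n \<noteq> y n" by (auto simp: fun_eq_iff)
    have "approximable S (\<lambda>x. x n)"
      unfolding approximable_def using continuous_on_evaluate[of S "Coord n"]
      by (auto intro: exI[of _ "Coord n"])
    then show "\<exists>f. approximable S f \<and> f x \<noteq> f y" using n by blast
  next
    show "continuous_on S f" if "approximable S f" for f using that by (simp add: approximable_def)
    show "approximable S (\<lambda>x. f x + g x)" if "approximable S f \<and> approximable S g" for f g
      using that by (simp add: approximable_add)
    show "approximable S (\<lambda>x. f x * g x)" if "approximable S f \<and> approximable S g" for f g
      using that by (simp add: approximable_mult[OF S])
  qed (use h e in auto)
  then obtain g where g: "approximable S g" "\<And>x. x \<in> S \<Longrightarrow> \<bar>h x - g x\<bar> < e/2" by blast
  obtain p where p: "\<And>x. x \<in> S \<Longrightarrow> \<bar>g x - evaluate p x\<bar> < e/2"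
    using g(1) e unfolding approximable_def by (meson half_gt_zero)
  have "\<bar>h x - evaluate p x\<bar> < e" if "x \<in> S" for x
    using g(2)[OF that] p[OF that] by linarith
  then show "\<exists>p. \<forall>x\<in>S. \<bar>h x - evaluate p x\<bar> < e" by blast
qed

text \<open>The separating sequence embeds each compact set as a compact set of real sequences, so the
  rational polynomials in the sequence approximate every continuous function there. The
  same countable set serves all compact sets at once.\<close>

lemma separating_sequence_imp_separable_Ck:
  fixes s :: "nat \<Rightarrow> 'a \<Rightarrow> real"
  assumes s: "\<And>n. continuous_map X euclideanreal (s n)"
    and sep: "\<And>x y. x \<in> topspace X \<Longrightarrow> y \<in> topspace X \<Longrightarrow> x \<noteq> y \<Longrightarrow> \<exists>n. s n x \<noteq> s n y"
  shows "separable_space (Ck X)"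
proof -
  define e where "e x = (\<lambda>n. s n x)" for x
  have e: "continuous_map X euclidean e"
    using s unfolding e_def euclidean_product_topology[symmetric] by (simp add: continuous_map_componentwise_UNIV)
  have inj: "inj_on e (topspace X)"
    using sep by (auto simp: inj_on_def e_def fun_eq_iff)
  define E where "E p = zero_extension X (\<lambda>x. evaluate p (e x))" for p
  have EC: "E p \<in> continuous_functions X" for p
    unfolding E_def
    using continuous_map_compose[OF e, of euclideanreal "evaluate p"] continuous_on_evaluate[of UNIV p]
    by (intro zero_extension_continuous_functions) (simp add: o_def)
  have "f \<in> Ck X closure_of range E" if f: "f \<in> continuous_functions X" for f
    unfolding in_closure_of
  proof (intro conjI allI impI)
    fix T assume "f \<in> T \<and> openin (Ck X) T"
    then obtain K d where K: "compactin X K" "d > 0" "uniform_ball X K d f \<subseteq> T"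
      unfolding openin_Ck by blast
    have KX: "K \<subseteq> topspace X" by (rule compactin_subset_topspace[OF K(1)])
    have image: "compact (e ` C)" if "compactin X C" for C
      using image_compactin[OF that e] by simp
    \<comment> \<open>\<open>f\<close> transported to the compact image of \<open>K\<close>; preimages of closed sets are images of compact sets\<close>
    define h where "h = f \<circ> inv_into K e"
    have injK: "inj_on e K" using inj KX by (rule inj_on_subset)
    have h: "h (e x) = f x" if "x \<in> K" for x
      using that injK by (simp add: h_def)
    have "continuous_on (e ` K) h"
    proof (subst continuous_on_closed_vimage)
      show "closed (e ` K)" by (intro compact_imp_closed image K(1))
      show "\<forall>B. closed B \<longrightarrow> closed (h -` B \<inter> e ` K)"
      proof (intro allI impI)
        fix B :: "real set" assume "closed B"
        then have "compact (e ` (K \<inter> {x. f x \<in> B}))"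
          by (intro image compactin_Int_closed_preimage f K(1))
        moreover have "h -` B \<inter> e ` K = e ` (K \<inter> {x. f x \<in> B})" using h by auto
        ultimately show "closed (h -` B \<inter> e ` K)" by (simp add: compact_imp_closed)
      qed
    qed
    then obtain p where p: "\<And>y. y \<in> e ` K \<Longrightarrow> \<bar>h y - evaluate p y\<bar> < d"
      using continuous_imp_approximable[OF image[OF K(1)]] K(2) unfolding approximable_def by blast
    have "\<bar>E p x - f x\<bar> < d" if "x \<in> K" for x
    proof -
      have "E p x = evaluate p (e x)" using that KX by (auto simp: E_def)
      then show ?thesis using p[of "e x"] h[OF that] that by (simp add: abs_minus_commute)
    qed
    then have "E p \<in> uniform_ball X K d f" using EC by (simp add: uniform_ball_def)
    then show "\<exists>y. y \<in> range E \<and> y \<in> T" using K(3) by blast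
  qed (use f in simp)
  moreover have "Ck X closure_of range E \<subseteq> continuous_functions X"
    using closure_of_subset_topspace[of "Ck X"] by simp
  ultimately have "Ck X closure_of range E = topspace (Ck X)" by auto
  then show ?thesis
    unfolding separable_space_def using EC by (intro exI[of _ "range E"]) auto
qed

context compact_exhaustion
begin

text \<open>Each stage is totally bounded for the continuous metric, so countably many centres come
  arbitrarily near every point. The distances to the centres separate points.\<close>

lemma submetrizable_imp_separating_sequence:
  assumes "submetrizable_space X"
  shows "\<exists>s :: nat \<Rightarrow> 'a \<Rightarrow> real. (\<forall>n. continuous_map X euclideanreal (s n)) \<and>
    (\<forall>x\<in>topspace X. \<forall>y\<in>topspace X. x \<noteq> y \<longrightarrow> (\<exists>n. s n x \<noteq> s n y))"
proof -
  obtain d where d: "Metric_space (topspace X) d"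
    and cont: "continuous_map (prod_topology X X) euclideanreal (\<lambda>(x, y). d x y)"
    using assms unfolding submetrizable_space_def by blast
  interpret M: Metric_space "topspace X" d by (rule d)
  have dc: "continuous_map X euclideanreal (d q)" if "q \<in> topspace X" for q
    using continuous_map_compose[OF _ cont, of X "\<lambda>x. (q, x)"] that
    by (simp add: continuous_map_pairwise o_def)
  have "\<exists>F. finite F \<and> F \<subseteq> topspace X \<and> K n \<subseteq> (\<Union>q\<in>F. {x \<in> topspace X. d q x \<in> {..<1 / real (Suc m)}})"
    (is "\<exists>F. ?P n m F") for n m
  proof -
    let ?B = "\<lambda>q. {x \<in> topspace X. d q x \<in> {..<1 / real (Suc m)}}"
    have "openin X U" if "U \<in> ?B ` K n" for U
    proof -
      obtain q where q: "q \<in> K n" "U = ?B q" using \<open>U \<in> ?B ` K n\<close> by blast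
      then have "q \<in> topspace X" using stage_subset by blast
      then show ?thesis unfolding q(2) by (intro openin_real_preimage dc) auto
    qed
    moreover have "x \<in> ?B x" if "x \<in> K n" for x
      using subsetD[OF stage_subset that] by simp
    then have "K n \<subseteq> \<Union>(?B ` K n)" by blast
    ultimately obtain \<F> where "finite \<F>" "\<F> \<subseteq> ?B ` K n" "K n \<subseteq> \<Union>\<F>"
      using compactinD[OF compactin_stage] by meson
    moreover from this obtain F where "F \<subseteq> K n" "finite F" "\<F> = ?B ` F"
      using finite_subset_image[of \<F> ?B "K n"] by auto
    ultimately have "finite F \<and> F \<subseteq> topspace X \<and> K n \<subseteq> (\<Union>q\<in>F. ?B q)"
      using subset_trans[OF _ stage_subset[of n]] by simp
    then show ?thesis by (rule exI)
  qed
  then have some: "?P n m (SOME F. ?P n m F)" for n m by (rule someI_ex)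
  define F where "F n m = (SOME F. ?P n m F)" for n m
  have F: "?P n m (F n m)" for n m unfolding F_def by (rule some)
  define Q where "Q = (\<Union>n m. F n m)"
  have "countable (F n m)" for n m using F by (intro countable_finite) blast
  then have "countable Q" unfolding Q_def by (intro countable_UN) auto
  have QX: "Q \<subseteq> topspace X" unfolding Q_def using F by blast
  define s where "s n = (if Q = {} then (\<lambda>_. 0) else d (from_nat_into Q n))" for n
  have "continuous_map X euclideanreal (s n)" for n
    using from_nat_into[of Q n] QX by (auto simp: s_def intro!: dc)
  moreover have "\<exists>n. s n x \<noteq> s n y" if xy: "x \<in> topspace X" "y \<in> topspace X" "x \<noteq> y" for x y
  proof -
    have "d x y > 0" using xy by simp
    then obtain m where m: "1 / real (Suc m) < d x y / 2"
      using nat_approx_posE[of "d x y / 2"] by auto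
    obtain n where n: "x \<in> K n" using stages_cover xy(1) by blast
    then obtain q where q: "q \<in> F n m" "d q x < 1 / real (Suc m)" using F[of n m] by blast
    have qQ: "q \<in> Q" "q \<in> topspace X" using q(1) QX unfolding Q_def by blast+
    have "d x y \<le> d q x + d q y" using M.triangle[of x q y] M.commute[of x q] xy qQ by simp
    then have "d q x \<noteq> d q y" using q(2) m by linarith
    then show ?thesis
      using from_nat_into_surj[OF \<open>countable Q\<close> qQ(1)] qQ(1) unfolding s_def by auto
  qed
  ultimately show ?thesis by blast
qed

proposition separable_Ck: 
  assumes "submetrizable_space X"
  shows "separable_space (Ck X)"
  using submetrizable_imp_separating_sequence[OF assms] separating_sequence_imp_separable_Ck by metis

proposition k_space_imp_frechet_Ck:
  assumes "k_space X"
  shows "frechet_space (Ck X)"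
  unfolding frechet_space_def topspace_Ck
  using Metric_space_stage_dist Ck_eq_mtopology mcomplete_stagewise locally_convex_space_Ck stage_dist_translate
  unfolding k_space_imp_stagewise[OF assms] by blast

end

lemma submetrizable_hemicompact_k_space_imp_frechet_Ck:
  assumes "submetrizable_space X" "hemicompact_space X" "k_space X"
  shows "frechet_space (Ck X)" "separable_space (Ck X)"
proof -
  obtain K where "compact_exhaustion X K"
    using hemicompact_space_imp_compact_exhaustion[OF assms(2)] by blast
  then interpret compact_exhaustion X K .
  show "frechet_space (Ck X)" by (rule k_space_imp_frechet_Ck[OF assms(3)])
  show "separable_space (Ck X)" by (rule separable_Ck[OF assms(1)])
qed

lemma frechet_imp_completely_metrizable:
  "frechet_space T \<Longrightarrow> completely_metrizable_space T"
  unfolding frechet_space_def completely_metrizable_space_def by metis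

lemma polish_Ck_imp_submetrizable_hemicompact_k_space:
  assumes X: "tychonoff_space X" and P: "polish_topology (Ck X)"
  shows "submetrizable_space X" "hemicompact_space X" "k_space X"
proof -
  have sep: "separable_space (Ck X)" and cm: "completely_metrizable_space (Ck X)"
    using P by (simp_all add: polish_topology_def)
  show "submetrizable_space X"
    using separable_finer_than_Cp_imp_submetrizable[OF X topspace_Ck _ sep] Ck_finer_than_Cp by blast
  show "hemicompact_space X"
    by (rule metrizable_Ck_imp_hemicompact[OF X completely_metrizable_imp_metrizable_space[OF cm]])
  then obtain K where "compact_exhaustion X K"
    using hemicompact_space_imp_compact_exhaustion by blast
  then interpret compact_exhaustion X K .
  show "k_space X"
    using completely_metrizable_Ck_imp_stagewise[OF _ cm] X
    by (intro stagewise_imp_k_space) (auto simp: tychonoff_space_def)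
qed

section \<open>Barrels and Lindelof spaces\<close>

text \<open>Two kinds of sequences have to be summed over arbitrary sets of indices: uniformly small ones
  and locally finite ones. A geometric bound that holds near each point from some index on
  covers both.\<close>

definition locally_dominated :: "'a topology \<Rightarrow> (nat \<Rightarrow> 'a \<Rightarrow> real) \<Rightarrow> bool" where
  "locally_dominated X g \<longleftrightarrow> (\<forall>x\<in>topspace X. \<exists>U N. openin X U \<and> x \<in> U \<and>
     (\<forall>i\<ge>N. \<forall>y\<in>U. \<bar>g i y\<bar> \<le> (1/2)^i))"

lemma locally_dominatedD:
  "locally_dominated X g \<Longrightarrow> x \<in> topspace X \<Longrightarrow>
    \<exists>U N. openin X U \<and> x \<in> U \<and> (\<forall>i\<ge>N. \<forall>y\<in>U. \<bar>g i y\<bar> \<le> (1/2)^i)"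
  by (simp add: locally_dominated_def)

lemma sum_fun_apply: "sum f A x = (\<Sum>i\<in>A. f i x)"
  by (induction A rule: infinite_finite_induct) auto

definition subsum :: "(nat \<Rightarrow> 'a \<Rightarrow> real) \<Rightarrow> nat set \<Rightarrow> 'a \<Rightarrow> real" where
  "subsum g A x = (\<Sum>i. if i \<in> A then g i x else 0)"

lemma subsum_finite: "finite A \<Longrightarrow> subsum g A = (\<Sum>i\<in>A. g i)"
  using sums_unique[OF sums_If_finite_set[of A "\<lambda>i. g i x" for x]]
  by (simp add: subsum_def fun_eq_iff sum_fun_apply)

lemma dominated_summable:
  fixes g :: "nat \<Rightarrow> 'a \<Rightarrow> real"
  assumes "\<forall>i\<ge>N. \<bar>g i y\<bar> \<le> (1/2)^i"
  shows "summable (\<lambda>i. if i \<in> A then g i y else 0)"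
proof (rule summable_comparison_test')
  show "summable (\<lambda>i. (1/2::real)^i)" by (rule summable_geometric) simp
  show "norm (if i \<in> A then g i y else 0) \<le> (1/2)^i" if "i \<ge> N" for i
    using assms that by auto
qed

lemma subsum_tail:
  fixes g :: "nat \<Rightarrow> 'a \<Rightarrow> real"
  assumes N: "\<forall>i\<ge>N. \<bar>g i y\<bar> \<le> (1/2)^i"
  shows "\<bar>subsum g A y - (\<Sum>i\<in>A \<inter> {..<N}. g i y)\<bar> \<le> 2 * (1/2)^N"
proof -
  define f where "f = (\<lambda>i. if i \<in> A then g i y else 0)"
  have s: "summable f" unfolding f_def by (rule dominated_summable[of N g y A, OF N])
  have geo: "(\<lambda>i. (1/2::real)^(i + N)) sums (2 * (1/2)^N)"
    using sums_mult2[OF geometric_sums[of "1/2::real"], of "(1/2)^N"] by (simp add: power_add)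
  have le: "norm (f (i + N)) \<le> (1/2)^(i + N)" for i
    using N by (auto simp: f_def)
  have "subsum g A y = (\<Sum>i. f (i + N)) + sum f {..<N}"
    using suminf_split_initial_segment[OF s, of N] by (simp add: subsum_def f_def)
  moreover have "sum f {..<N} = (\<Sum>i\<in>A \<inter> {..<N}. g i y)"
    unfolding f_def by (subst sum.If_cases) (auto simp: Int_commute)
  moreover have "\<bar>\<Sum>i. f (i + N)\<bar> \<le> 2 * (1/2)^N"
    using norm_suminf_le[OF le sums_summable[OF geo]] sums_unique[OF geo] by simp
  ultimately show ?thesis by simp
qed

lemma half_power_small: "e > 0 \<Longrightarrow> \<exists>N\<ge>m. 2 * (1/2::real)^N < e"
proof -
  assume "e > 0"
  then obtain n where n: "(1/2::real)^n < e/2" using real_arch_pow_inv[of "e/2" "1/2"] by auto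
  have "(1/2::real)^(max m n) \<le> (1/2)^n" by (rule power_decreasing) auto
  then have "2 * (1/2::real)^(max m n) < e" using n by linarith
  then show ?thesis by (intro exI[of _ "max m n"]) auto
qed

lemma subsum_continuous:
  assumes g: "\<And>i. g i \<in> continuous_functions X" and dom: "locally_dominated X g"
  shows "subsum g A \<in> continuous_functions X"
proof -
  have "continuous_map X euclideanreal (subsum g A)"
  proof (rule continuous_real_local_approx)
    fix x and e :: real assume x: "x \<in> topspace X" and e: "e > 0"
    obtain U N0 where U: "openin X U" "x \<in> U" and N0: "\<forall>i\<ge>N0. \<forall>y\<in>U. \<bar>g i y\<bar> \<le> (1/2)^i"
      using locally_dominatedD[OF dom x] by (elim exE conjE) (rule that)
    obtain N where N: "N \<ge> N0" "2 * (1/2::real)^N < e" using half_power_small[OF e] by blast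
    have "\<bar>subsum g A y - (\<Sum>i\<in>A \<inter> {..<N}. g i) y\<bar> \<le> e" if y: "y \<in> U" for y
    proof -
      have "\<forall>i\<ge>N. \<bar>g i y\<bar> \<le> (1/2)^i" using N0 N(1) y by auto
      then have "\<bar>subsum g A y - (\<Sum>i\<in>A \<inter> {..<N}. g i y)\<bar> \<le> 2 * (1/2)^N" by (rule subsum_tail)
      then show ?thesis using N(2) by (simp add: sum_fun_apply)
    qed
    moreover have "continuous_map X euclideanreal (\<Sum>i\<in>A \<inter> {..<N}. g i)"
      by (intro continuous_functionsD(1) continuous_functions_sum g)
    ultimately show "\<exists>U h. openin X U \<and> x \<in> U \<and> continuous_map X euclideanreal h \<and>
        (\<forall>y\<in>U. \<bar>subsum g A y - h y\<bar> \<le> e)" using U by blast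
  qed
  moreover have "subsum g A x = 0" if "x \<notin> topspace X" for x
    using continuous_functionsD(2)[OF g that] by (simp add: subsum_def cong: if_cong)
  ultimately show ?thesis by (simp add: continuous_functions_def)
qed

lemma locally_dominated_compactin:
  assumes dom: "locally_dominated X g" and C: "compactin X C"
  shows "\<exists>N. \<forall>i\<ge>N. \<forall>y\<in>C. \<bar>g i y\<bar> \<le> (1/2)^i"
proof -
  have CX: "C \<subseteq> topspace X" by (rule compactin_subset_topspace[OF C])
  have "\<exists>U N. openin X U \<and> x \<in> U \<and> (\<forall>i\<ge>N. \<forall>y\<in>U. \<bar>g i y\<bar> \<le> (1/2)^i)" if "x \<in> C" for x
    using CX that by (intro locally_dominatedD[OF dom]) auto
  then obtain U N where U: "\<And>x. x \<in> C \<Longrightarrow> openin X (U x)" "\<And>x. x \<in> C \<Longrightarrow> x \<in> U x"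
    and N: "\<And>x i y. x \<in> C \<Longrightarrow> i \<ge> N x \<Longrightarrow> y \<in> U x \<Longrightarrow> \<bar>g i y\<bar> \<le> (1/2)^i"
    by metis
  have "C \<subseteq> \<Union>(U ` C)" using U(2) by blast
  then obtain \<F> where "finite \<F>" "\<F> \<subseteq> U ` C" "C \<subseteq> \<Union>\<F>"
    using compactinD[OF C, of "U ` C"] U(1) by blast
  moreover from this obtain F where F: "F \<subseteq> C" "finite F" "\<F> = U ` F"
    using finite_subset_image[of \<F> U C] by auto
  ultimately have cover: "C \<subseteq> (\<Union>x\<in>F. U x)" by simp
  have "\<bar>g i y\<bar> \<le> (1/2)^i" if i: "i \<ge> (\<Sum>x\<in>F. N x)" and y: "y \<in> C" for i y
  proof -
    obtain x where x: "x \<in> F" "y \<in> U x" using cover y by blast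
    have "N x \<le> (\<Sum>x\<in>F. N x)" using F(2) x(1) by (intro member_le_sum) auto
    then show ?thesis using N[of x i y] x F(1) i by auto
  qed
  then show ?thesis by blast
qed

text \<open>For convex symmetric sets, absorbing a function amounts to containing a single positive
  multiple of it.\<close>

definition barrel :: "'a topology \<Rightarrow> ('a \<Rightarrow> real) set \<Rightarrow> bool" where
  "barrel X B \<longleftrightarrow> closedin (Ck X) B \<and> convex B \<and> (\<forall>f\<in>B. - f \<in> B) \<and>
     (\<forall>f\<in>continuous_functions X. \<exists>t>0. t *\<^sub>R f \<in> B)"

text \<open>Multiplying a member of the barrel by an arbitrary continuous function can lead out of the
  barrel. The functions all of whose multiples stay inside form an ideal of the ring of continuous
  functions; its common zeros replace the support of a measure.\<close>

definition barrel_ideal :: "'a topology \<Rightarrow> ('a \<Rightarrow> real) set \<Rightarrow> ('a \<Rightarrow> real) set" where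
  "barrel_ideal X B = {u \<in> continuous_functions X. \<forall>f\<in>continuous_functions X. f * u \<in> B}"

definition barrel_support :: "'a topology \<Rightarrow> ('a \<Rightarrow> real) set \<Rightarrow> 'a set" where
  "barrel_support X B = {x \<in> topspace X. \<forall>u\<in>barrel_ideal X B. u x = 0}"

context
  fixes X :: "'a topology" and B :: "('a \<Rightarrow> real) set"
  assumes barrel: "barrel X B"
begin

lemma barrel_midpoint: "2 *\<^sub>R f \<in> B \<Longrightarrow> 2 *\<^sub>R g \<in> B \<Longrightarrow> f + g \<in> B"
  using convexD[of B "2 *\<^sub>R f" "2 *\<^sub>R g" "1/2" "1/2"] barrel by (simp add: barrel_def)

lemma barrel_zero: "0 \<in> B"
  using barrel continuous_functions_zero[of X] unfolding barrel_def by fastforce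

lemma barrel_scale:
  assumes "f \<in> B" "0 \<le> t" "t \<le> 1"
  shows "t *\<^sub>R f \<in> B"
  using convexD[of B f 0 t "1 - t"] assms barrel_zero barrel by (simp add: barrel_def)

lemma barrel_scale_smaller:
  assumes "s *\<^sub>R f \<in> B" "0 \<le> t" "t \<le> s"
  shows "t *\<^sub>R f \<in> B"
proof (cases "s = 0")
  case False
  then show ?thesis using barrel_scale[OF assms(1), of "t / s"] assms(2,3) by simp
qed (use assms in simp)

lemma scaled_complement_open:
  assumes f: "f \<in> continuous_functions X" "c *\<^sub>R f \<notin> B" and c: "c > 0"
  shows "\<exists>K e. compactin X K \<and> e > 0 \<and> (\<forall>g\<in>uniform_ball X K e f. c *\<^sub>R g \<notin> B)"
proof -
  have "openin (Ck X) (continuous_functions X - B)"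
    using barrel by (simp add: barrel_def closedin_def)
  moreover have "c *\<^sub>R f \<in> continuous_functions X - B"
    using f continuous_functions_scale[OF f(1)] by simp
  ultimately obtain K e where K: "compactin X K" "e > 0"
    "uniform_ball X K e (c *\<^sub>R f) \<subseteq> continuous_functions X - B"
    using openin_CkD by blast
  have "c *\<^sub>R g \<in> uniform_ball X K e (c *\<^sub>R f)" if g: "g \<in> uniform_ball X K (e / c) f" for g
  proof -
    have "\<bar>(c *\<^sub>R g) x - (c *\<^sub>R f) x\<bar> < e" if x: "x \<in> K" for x
    proof -
      have "c * \<bar>g x - f x\<bar> < e"
        using g x c by (simp add: uniform_ball_def less_divide_eq mult.commute)
      moreover have "\<bar>(c *\<^sub>R g) x - (c *\<^sub>R f) x\<bar> = c * \<bar>g x - f x\<bar>"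
        using c by (simp add: right_diff_distrib[symmetric] abs_mult)
      ultimately show ?thesis by simp
    qed
    then show ?thesis using g by (simp add: uniform_ball_def continuous_functions_scale)
  qed
  then show ?thesis using K c by (intro exI[of _ K] exI[of _ "e / c"]) auto
qed

text \<open>Baire's argument on the space of sets of natural numbers. A barrel absorbs the sum over each set
  of indices, so some multiple of the barrel contains the sums over a nonempty open set of
  them. Otherwise nested cylinders, the \<open>n\<close>-th avoiding the \<open>n\<close>-th multiple of the barrel, shrink to a
  set whose sum is not absorbed.\<close>

lemma subsum_cylinder:
  assumes g: "\<And>i. g i \<in> continuous_functions X" and dom: "locally_dominated X g"
  shows "\<exists>m A N. \<forall>A'. A' \<inter> {..<N} = A \<inter> {..<N} \<longrightarrow> (1 / real (Suc m)) *\<^sub>R subsum g A' \<in> B"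
proof (rule ccontr)
  assume "\<not> ?thesis"
  then have all: "\<forall>m A N. \<exists>A'. A' \<inter> {..<N} = A \<inter> {..<N} \<and> (1 / real (Suc m)) *\<^sub>R subsum g A' \<notin> B"
    by (simp only: not_ex not_all not_imp simp_thms)
  have escape: "\<exists>A'. A' \<inter> {..<N} = A \<inter> {..<N} \<and> (1 / real (Suc m)) *\<^sub>R subsum g A' \<notin> B" for m A N
    by (rule spec[OF spec[OF spec[OF all, of m], of A], of N])
  \<comment> \<open>the complement of the barrel is open and the tails of the sums are small on compact sets\<close>
  have stay: "\<exists>M\<ge>N. \<forall>A'. A' \<inter> {..<M} = A \<inter> {..<M} \<longrightarrow> (1 / real (Suc m)) *\<^sub>R subsum g A' \<notin> B"
    if A: "(1 / real (Suc m)) *\<^sub>R subsum g A \<notin> B" for m A N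
  proof -
    obtain K e where K: "compactin X K" "e > 0"
      and far: "\<And>h. h \<in> uniform_ball X K e (subsum g A) \<Longrightarrow> (1 / real (Suc m)) *\<^sub>R h \<notin> B"
      using scaled_complement_open[OF subsum_continuous[OF g dom] A] by auto
    obtain N1 where N1: "\<forall>i\<ge>N1. \<forall>y\<in>K. \<bar>g i y\<bar> \<le> (1/2)^i"
      using locally_dominated_compactin[OF dom K(1)] by blast
    obtain M where M: "M \<ge> max N N1" "2 * (1/2::real)^M < e/2"
      using half_power_small[of "e/2" "max N N1"] half_gt_zero[OF K(2)] by blast
    have "subsum g A' \<in> uniform_ball X K e (subsum g A)" if A': "A' \<inter> {..<M} = A \<inter> {..<M}" for A'
      unfolding uniform_ball_def
    proof (intro CollectI conjI ballI subsum_continuous[OF g dom])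
      fix y assume "y \<in> K"
      then have "\<forall>i\<ge>M. \<bar>g i y\<bar> \<le> (1/2)^i" using N1 M(1) by auto
      then show "\<bar>subsum g A' y - subsum g A y\<bar> < e"
        using subsum_tail[of M g y A] subsum_tail[of M g y A'] M(2) A' by fastforce
    qed
    then show ?thesis using far M(1) by (intro exI[of _ M]) auto
  qed
  define P where "P n p \<longleftrightarrow> (\<forall>A'. A' \<inter> {..<snd p} = fst p \<inter> {..<snd p} \<longrightarrow>
      (1 / real (Suc n)) *\<^sub>R subsum g A' \<notin> B)" for n and p :: "nat set \<times> nat"
  define Q where "Q p q \<longleftrightarrow> snd p \<le> snd q \<and> fst q \<inter> {..<snd p} = fst p \<inter> {..<snd p}" for p q :: "nat set \<times> nat"
  have next': "\<exists>q. P n q \<and> Q p q" for n p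
  proof -
    obtain A' where A': "A' \<inter> {..<snd p} = fst p \<inter> {..<snd p}" "(1 / real (Suc n)) *\<^sub>R subsum g A' \<notin> B"
      using escape[where N = "snd p" and A = "fst p" and m = n] by blast
    obtain M where "M \<ge> snd p" "\<forall>A''. A'' \<inter> {..<M} = A' \<inter> {..<M} \<longrightarrow> (1 / real (Suc n)) *\<^sub>R subsum g A'' \<notin> B"
      using stay[OF A'(2)] by blast
    then show ?thesis using A'(1) by (intro exI[of _ "(A', M)"]) (simp add: P_def Q_def)
  qed
  have "\<exists>s. \<forall>n. P n (s n) \<and> Q (s n) (s (Suc n))"
  proof (rule dependent_nat_choice)
    show "\<exists>p. P 0 p" using next'[of 0 undefined] by blast
    show "\<exists>q. P (Suc n) q \<and> Q p q" for p n by (rule next')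
  qed
  then obtain s where P: "\<And>n. P n (s n)" and Q: "\<And>n. Q (s n) (s (Suc n))" by blast
  have coh: "snd (s n) \<le> snd (s m) \<and> fst (s m) \<inter> {..<snd (s n)} = fst (s n) \<inter> {..<snd (s n)}" if "n \<le> m" for n m
    using that
  proof (induction m rule: dec_induct)
    case (step m)
    have "fst (s (Suc m)) \<inter> {..<snd (s m)} = fst (s m) \<inter> {..<snd (s m)}" "snd (s m) \<le> snd (s (Suc m))"
      using Q[of m] by (simp_all add: Q_def)
    moreover have IH: "snd (s n) \<le> snd (s m)" "fst (s m) \<inter> {..<snd (s n)} = fst (s n) \<inter> {..<snd (s n)}"
      using step.IH by simp_all
    moreover have "S \<inter> {..<snd (s n)} = S \<inter> {..<snd (s m)} \<inter> {..<snd (s n)}" for S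
      using IH(1) by auto
    ultimately show ?case by (metis order_trans)
  qed simp
  define A where "A = {i. \<exists>n. i < snd (s n) \<and> i \<in> fst (s n)}"
  have agree: "A \<inter> {..<snd (s n)} = fst (s n) \<inter> {..<snd (s n)}" for n
  proof -
    have "i \<in> fst (s n)" if i: "i < snd (s n)" "i < snd (s m)" "i \<in> fst (s m)" for i m
    proof (cases "n \<le> m")
      case True
      have "i \<in> fst (s m) \<inter> {..<snd (s n)}" using i by simp
      then show ?thesis using coh[OF True] by blast
    next
      case False
      then have "fst (s n) \<inter> {..<snd (s m)} = fst (s m) \<inter> {..<snd (s m)}" using coh[of m n] by simp
      then show ?thesis using i by blast
    qed
    then show ?thesis unfolding A_def by blast
  qed
  then have out: "(1 / real (Suc n)) *\<^sub>R subsum g A \<notin> B" for n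
    using P[of n] unfolding P_def by blast
  obtain t where t: "t > 0" "t *\<^sub>R subsum g A \<in> B"
    using barrel subsum_continuous[OF g dom, of A] unfolding barrel_def by blast
  obtain n where "1 / real (Suc n) < t" using nat_approx_posE[OF t(1)] by blast
  then show False using barrel_scale_smaller[OF t(2), of "1 / real (Suc n)"] out[of n] by simp
qed

text \<open>Two sets of indices in the cylinder that differ by one large index \<open>i\<close> have sums that differ
  by \<open>g i\<close>. So a fixed multiple of the barrel contains almost all \<open>g i\<close>, whereas the scaling
  by \<open>i + 1\<close> allowed in the conclusion is unbounded.\<close>

lemma locally_dominated_absorbed:
  assumes g: "\<And>i. g i \<in> continuous_functions X" and dom: "locally_dominated X g"
  shows "\<exists>i. (1 / real (Suc i)) *\<^sub>R g i \<in> B"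
proof -
  obtain m A N where cyl: "\<And>A'. A' \<inter> {..<N} = A \<inter> {..<N} \<Longrightarrow> (1 / real (Suc m)) *\<^sub>R subsum g A' \<in> B"
    using subsum_cylinder[OF g dom] by blast
  \<comment> \<open>beyond the cylinder, and large enough to absorb the factor lost by the midpoint\<close>
  define i where "i = max N (2 * Suc m)"
  define A0 where "A0 = A \<inter> {..<N}"
  define c where "c = 1 / real (Suc m)"
  have fin: "finite A0" and iA: "i \<notin> A0" by (auto simp: A0_def i_def)
  have "c *\<^sub>R subsum g (insert i A0) \<in> B" "c *\<^sub>R subsum g A0 \<in> B"
    unfolding c_def by (rule cyl, force simp: A0_def i_def)+
  moreover have "subsum g (insert i A0) = g i + subsum g A0"
    using fin iA by (simp add: subsum_finite)
  ultimately have 1: "c *\<^sub>R (g i + subsum g A0) \<in> B" and 2: "- (c *\<^sub>R subsum g A0) \<in> B"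
    using barrel unfolding barrel_def by simp_all
  have "(c/2) *\<^sub>R (g i + subsum g A0) + - ((c/2) *\<^sub>R subsum g A0) \<in> B"
    using 1 2 by (intro barrel_midpoint) (simp_all add: fun_eq_iff)
  then have "(c/2) *\<^sub>R g i \<in> B" by (simp add: scaleR_right_distrib)
  moreover have "1 / real (Suc i) \<le> c/2"
    by (auto simp: i_def c_def field_simps)
  ultimately show ?thesis using barrel_scale_smaller by (meson divide_nonneg_nonneg of_nat_0_le_iff zero_le_one)
qed

text \<open>A counterexample at each scale would give functions outside the barrel so small that even
  their multiples by \<open>i + 1\<close> are dominated.\<close>

lemma barrel_contains_sup_ball:
  "\<exists>\<delta>>0. \<forall>f\<in>continuous_functions X. (\<forall>x. \<bar>f x\<bar> \<le> \<delta>) \<longrightarrow> f \<in> B"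
proof (rule ccontr)
  assume "\<not> ?thesis"
  then have "\<exists>f\<in>continuous_functions X. (\<forall>x. \<bar>f x\<bar> \<le> (1/2)^i / real (Suc i)) \<and> f \<notin> B" for i
    by (metis divide_pos_pos of_nat_0_less_iff zero_less_Suc zero_less_power half_gt_zero zero_less_one)
  then obtain f where f: "\<And>i. f i \<in> continuous_functions X" "\<And>i x. \<bar>f i x\<bar> \<le> (1/2)^i / real (Suc i)" "\<And>i. f i \<notin> B"
    by metis
  define g where "g i = real (Suc i) *\<^sub>R f i" for i
  have "\<bar>g i x\<bar> \<le> (1/2)^i" for i x
  proof -
    have "\<bar>g i x\<bar> = real (Suc i) * \<bar>f i x\<bar>" by (simp add: g_def abs_mult del: of_nat_Suc)
    also have "\<dots> \<le> real (Suc i) * ((1/2)^i / real (Suc i))" by (intro mult_left_mono f(2)) simp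
    finally show ?thesis by (simp del: of_nat_Suc)
  qed
  then have "locally_dominated X g" unfolding locally_dominated_def by (metis openin_topspace)
  moreover have "g i \<in> continuous_functions X" for i unfolding g_def by (intro continuous_functions_scale f)
  ultimately obtain i where "(1 / real (Suc i)) *\<^sub>R g i \<in> B" using locally_dominated_absorbed by blast
  then show False using f(3)[of i] by (simp add: g_def)
qed

text \<open>The hypothesis on \<open>h\<close> is invariant under rescaling, so the multiples by \<open>i + 1\<close> are
  locally dominated too.\<close>

lemma locally_finite_meets_barrel:
  fixes h :: "nat \<Rightarrow> 'a \<Rightarrow> real"
  assumes h: "\<And>i. h i \<in> continuous_functions X"
    and V: "\<And>i. openin X (V i)" "topspace X \<subseteq> (\<Union>i. V i)"
    and zero: "\<And>i j x. i \<le> j \<Longrightarrow> x \<in> V i \<Longrightarrow> h j x = 0"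
  shows "\<exists>i. h i \<in> B"
proof -
  define g where "g i = real (Suc i) *\<^sub>R h i" for i
  have "\<exists>U N. openin X U \<and> x \<in> U \<and> (\<forall>i\<ge>N. \<forall>y\<in>U. \<bar>g i y\<bar> \<le> (1/2)^i)" if x: "x \<in> topspace X" for x
  proof -
    obtain n where "x \<in> V n" using subsetD[OF V(2) x] by blast
    moreover have "\<forall>i\<ge>n. \<forall>y\<in>V n. \<bar>g i y\<bar> \<le> (1/2)^i" using zero by (simp add: g_def)
    ultimately show ?thesis using V(1) by blast
  qed
  then have "locally_dominated X g" unfolding locally_dominated_def by blast
  moreover have "g i \<in> continuous_functions X" for i unfolding g_def by (intro continuous_functions_scale h)
  ultimately obtain i where "(1 / real (Suc i)) *\<^sub>R g i \<in> B" using locally_dominated_absorbed by blast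
  then show ?thesis by (auto simp: g_def)
qed

lemma barrel_ideal_subset: "barrel_ideal X B \<subseteq> continuous_functions X"
  by (auto simp: barrel_ideal_def)

lemma barrel_ideal_zero: "0 \<in> barrel_ideal X B"
  using barrel_zero continuous_functions_zero by (simp add: barrel_ideal_def)

lemma barrel_ideal_add:
  assumes "u \<in> barrel_ideal X B" "v \<in> barrel_ideal X B"
  shows "u + v \<in> barrel_ideal X B"
  unfolding barrel_ideal_def
proof (intro CollectI conjI ballI)
  show "u + v \<in> continuous_functions X"
    using assms barrel_ideal_subset by (auto intro: continuous_functions_add)
  fix f assume f: "f \<in> continuous_functions X"
  \<comment> \<open>doubling \<open>f\<close> first makes the sum a midpoint\<close>
  have *: "2 *\<^sub>R (f * w) \<in> B" if "w \<in> barrel_ideal X B" for w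
  proof -
    have "(2 *\<^sub>R f) * w \<in> B"
      using that continuous_functions_scale[OF f, of 2] by (simp add: barrel_ideal_def)
    moreover have "(2 *\<^sub>R f) * w = 2 *\<^sub>R (f * w)" by (simp add: fun_eq_iff)
    ultimately show ?thesis by simp
  qed
  then show "f * (u + v) \<in> B"
    using barrel_midpoint[OF *[OF assms(1)] *[OF assms(2)]] by (simp add: distrib_left)
qed

lemma barrel_ideal_mult:
  assumes "u \<in> barrel_ideal X B" "w \<in> continuous_functions X"
  shows "w * u \<in> barrel_ideal X B"
  using assms continuous_functions_mult[of _ X] unfolding barrel_ideal_def
  by (auto simp: mult.assoc[symmetric])

lemma barrel_ideal_sum:
  "finite I \<Longrightarrow> (\<And>i. i \<in> I \<Longrightarrow> u i \<in> barrel_ideal X B) \<Longrightarrow> sum u I \<in> barrel_ideal X B"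
  by (induction I rule: finite_induct) (auto simp: barrel_ideal_zero barrel_ideal_add)

lemma barrel_ideal_scale_in_barrel:
  assumes "u \<in> barrel_ideal X B"
  shows "c *\<^sub>R u \<in> B"
proof -
  have "zero_extension X (\<lambda>_. c) \<in> continuous_functions X"
    by (rule zero_extension_continuous_functions) simp
  then have "zero_extension X (\<lambda>_. c) * u \<in> B" using assms by (simp add: barrel_ideal_def)
  moreover have "zero_extension X (\<lambda>_. c) * u = c *\<^sub>R u"
    using assms barrel_ideal_subset by (auto simp: fun_eq_iff zero_extension_def dest: continuous_functionsD(2))
  ultimately show ?thesis by simp
qed

lemma locally_finite_meets_barrel_ideal:
  fixes h :: "nat \<Rightarrow> 'a \<Rightarrow> real"
  assumes h: "\<And>i. h i \<in> continuous_functions X"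
    and V: "\<And>i. openin X (V i)" "topspace X \<subseteq> (\<Union>i. V i)"
    and zero: "\<And>i j x. i \<le> j \<Longrightarrow> x \<in> V i \<Longrightarrow> h j x = 0"
  shows "\<exists>i. h i \<in> barrel_ideal X B"
proof (rule ccontr)
  assume "\<not> ?thesis"
  then have "\<exists>f. f \<in> continuous_functions X \<and> f * h i \<notin> B" for i using h by (auto simp: barrel_ideal_def)
  then obtain f where f: "\<And>i. f i \<in> continuous_functions X" "\<And>i. f i * h i \<notin> B" by metis
  have "\<exists>i. f i * h i \<in> B"
    by (rule locally_finite_meets_barrel[OF _ V]) (use f h zero in \<open>auto intro: continuous_functions_mult\<close>)
  then show False using f(2) by blast
qed

lemma closedin_barrel_support: "closedin X (barrel_support X B)"
proof -
  have "barrel_support X B = topspace X \<inter> (\<Inter>u\<in>barrel_ideal X B. {x \<in> topspace X. u x \<in> {0}})"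
    by (auto simp: barrel_support_def)
  moreover have "closedin X {x \<in> topspace X. u x \<in> {0}}" if "u \<in> barrel_ideal X B" for u
    using that barrel_ideal_subset continuous_functionsD(1) by (intro closedin_real_preimage) auto
  ultimately show ?thesis
    using barrel_ideal_zero by (simp only:) (intro closedin_Int closedin_Inter closedin_topspace, auto)
qed

text \<open>The excesses of \<open>\<bar>f\<bar>\<close> over the natural numbers form a locally finite sequence, so one of them lies in
  the ideal and vanishes on the support.\<close>

lemma barrel_support_bounding:
  assumes f: "f \<in> continuous_functions X"
  shows "\<exists>M. \<forall>x\<in>barrel_support X B. \<bar>f x\<bar> \<le> M"
proof -
  define h where "h i = zero_extension X (\<lambda>x. max 0 (\<bar>f x\<bar> - real i))" for i
  have fc: "continuous_map X euclideanreal f" by (rule continuous_functionsD(1)[OF f])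
  have "\<exists>i. h i \<in> barrel_ideal X B"
  proof (rule locally_finite_meets_barrel_ideal)
    show "h i \<in> continuous_functions X" for i
      unfolding h_def
      by (intro zero_extension_continuous_functions continuous_real_compose[OF fc]) (intro continuous_intros)
    show "openin X {x \<in> topspace X. f x \<in> {- real i<..<real i}}" for i
      by (rule openin_real_preimage[OF fc]) simp
    show "topspace X \<subseteq> (\<Union>i. {x \<in> topspace X. f x \<in> {- real i<..<real i}})"
    proof
      fix x assume "x \<in> topspace X"
      moreover obtain n where "\<bar>f x\<bar> < real n" using reals_Archimedean2 by blast
      ultimately show "x \<in> (\<Union>i. {x \<in> topspace X. f x \<in> {- real i<..<real i}})"
        by (intro UN_I[of n]) (auto simp: abs_less_iff)
    qed
    show "h j x = 0" if "i \<le> j" "x \<in> {x \<in> topspace X. f x \<in> {- real i<..<real i}}" for i j x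
      using that by (auto simp: h_def max_def)
  qed
  then obtain i where "h i \<in> barrel_ideal X B" by blast
  then have "\<bar>f x\<bar> \<le> real i" if "x \<in> barrel_support X B" for x
    using that by (force simp: barrel_support_def h_def max_def split: if_splits)
  then show ?thesis by blast
qed

end

lemma Lindelof_nonvanishing_sequence:
  assumes L: "Lindelof_space X" and F: "F \<subseteq> continuous_functions X" "F \<noteq> {}"
    and nz: "\<And>x. x \<in> topspace X \<Longrightarrow> \<exists>u\<in>F. u x \<noteq> 0"
  shows "\<exists>s :: nat \<Rightarrow> 'a \<Rightarrow> real. range s \<subseteq> F \<and> (\<forall>x\<in>topspace X. \<exists>i. s i x \<noteq> 0)"
proof -
  let ?D = "\<lambda>u. {x \<in> topspace X. u x \<in> - {0}}"
  have "openin X (?D u)" if "u \<in> F" for u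
    using that F(1) continuous_functionsD(1) by (intro openin_real_preimage) auto
  moreover have "\<Union>(?D ` F) = topspace X" using nz by auto
  ultimately have "\<exists>\<V>. countable \<V> \<and> \<V> \<subseteq> ?D ` F \<and> \<Union>\<V> = topspace X"
    by (intro Lindelof_spaceD[OF L]) auto
  then obtain \<V> where \<V>: "countable \<V>" "\<V> \<subseteq> ?D ` F" "\<Union>\<V> = topspace X" by (elim exE conjE)
  then have "\<exists>F'. countable F' \<and> F' \<subseteq> F \<and> \<V> = ?D ` F'"
    by (intro iffD1[OF countable_subset_image] conjI)
  then obtain F' where F': "countable F'" "F' \<subseteq> F" "\<V> = ?D ` F'" by (elim exE conjE)
  obtain u0 where u0: "u0 \<in> F" using F(2) by blast
  define s where "s = from_nat_into (insert u0 F')"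
  have "range s = insert u0 F'"
    using F'(1) unfolding s_def by (intro range_from_nat_into) auto
  moreover have "\<exists>u\<in>F'. u x \<noteq> 0" if "x \<in> topspace X" for x
  proof -
    have "x \<in> \<Union>(?D ` F')" using \<V>(3) F'(3) that by simp
    then show ?thesis by auto
  qed
  ultimately show ?thesis using u0 F'(2) by (intro exI[of _ s]) (metis insert_iff insert_subset rangeE)
qed

text \<open>A countable cozero refinement of a cover has a positive sum \<open>h\<close> with geometric weights. If \<open>1 / h\<close> is
  bounded on \<open>S\<close>, then the tail of the sum is too small there to keep \<open>h\<close> away from \<open>0\<close>, so
  finitely many of the cozero sets cover \<open>S\<close>.\<close>

lemma Lindelof_closed_bounding_imp_compactin:
  assumes X: "tychonoff_space X" and L: "Lindelof_space X" and S: "closedin X S"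
    and bd: "\<And>f. f \<in> continuous_functions X \<Longrightarrow> \<exists>M. \<forall>x\<in>S. \<bar>f x\<bar> \<le> M"
  shows "compactin X S"
  unfolding compactin_def
proof (intro conjI allI impI)
  show "S \<subseteq> topspace X" using S by (rule closedin_subset)
  fix \<U> assume U: "(\<forall>U\<in>\<U>. openin X U) \<and> S \<subseteq> \<Union>\<U>"
  \<comment> \<open>functions vanishing off a member of the cover, or on all of \<open>S\<close>\<close>
  define F where "F = {u \<in> continuous_functions X. (\<forall>y. 0 \<le> u y \<and> u y \<le> 1) \<and>
     ((\<forall>y\<in>S. u y = 0) \<or> (\<exists>U\<in>\<U>. \<forall>y\<in>topspace X - U. u y = 0))}"
  have "\<exists>u\<in>F. u x \<noteq> 0" if x: "x \<in> topspace X" for x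
  proof (cases "x \<in> S")
    case True
    then obtain U where "U \<in> \<U>" "x \<in> U" using U by blast
    moreover then have "closedin X (topspace X - U)" using U by blast
    ultimately show ?thesis
      using tychonoff_space_separation[OF X, of "topspace X - U" x] x unfolding F_def by fastforce
  next
    case False
    then show ?thesis
      using tychonoff_space_separation[OF X S x] unfolding F_def by fastforce
  qed
  moreover have "F \<noteq> {}" using continuous_functions_zero[of X] unfolding F_def by fastforce
  moreover have "F \<subseteq> continuous_functions X" by (auto simp: F_def)
  ultimately obtain s where s: "range s \<subseteq> F" and nz: "\<And>x. x \<in> topspace X \<Longrightarrow> \<exists>i::nat. s i x \<noteq> 0"
    using Lindelof_nonvanishing_sequence[OF L] by metis
  have sF: "s i \<in> F" for i using s by blast
  have s01: "0 \<le> s i y" "s i y \<le> 1" for i y using sF[of i] by (auto simp: F_def)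
  define g where "g i = (1/2)^i *\<^sub>R s i" for i
  have gC: "g i \<in> continuous_functions X" for i
    using sF[of i] unfolding g_def F_def by (auto intro: continuous_functions_scale)
  have g: "0 \<le> g i y" "\<bar>g i y\<bar> \<le> (1/2)^i" for i y
    using s01[of i y] by (auto simp: g_def abs_mult mult_left_le)
  have dom: "locally_dominated X g"
    unfolding locally_dominated_def using g(2) openin_topspace by blast
  define h where "h = subsum g UNIV"
  have hC: "h \<in> continuous_functions X" unfolding h_def by (rule subsum_continuous[OF gC dom])
  have hpos: "h x > 0" if x: "x \<in> topspace X" for x
  proof -
    obtain i where "s i x \<noteq> 0" using nz[OF x] by blast
    then have "g i x > 0" using s01(1)[of i x] by (simp add: g_def)
    moreover have "summable (\<lambda>i. g i x)"
      using dominated_summable[of 0 g x UNIV] g(2) by simp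
    ultimately have "0 < (\<Sum>i. g i x)" using g(1) by (intro suminf_pos2[of _ i]) auto
    then show ?thesis by (simp add: h_def subsum_def)
  qed
  have "zero_extension X (\<lambda>x. 1 / h x) \<in> continuous_functions X"
    using hpos continuous_functionsD(1)[OF hC]
    by (intro zero_extension_continuous_functions continuous_map_real_divide) force+
  then obtain M where M: "\<And>x. x \<in> S \<Longrightarrow> \<bar>zero_extension X (\<lambda>x. 1 / h x) x\<bar> \<le> M" using bd by blast
  define M' where "M' = \<bar>M\<bar> + 1"
  have hM: "1 / M' \<le> h x" if x: "x \<in> S" for x
  proof -
    have xX: "x \<in> topspace X" using x closedin_subset[OF S] by blast
    then have "1 / h x \<le> M'" using M[OF x] hpos[OF xX] by (simp add: M'_def)
    then show ?thesis using hpos[OF xX] by (simp add: M'_def field_simps)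
  qed
  have "1 / M' > 0" by (simp add: M'_def)
  then obtain N where N: "2 * (1/2::real)^N < 1 / M'"
    using half_power_small[of "1 / M'" 0] by blast
  have "\<exists>i<N. s i x \<noteq> 0" if x: "x \<in> S" for x
  proof (rule ccontr)
    assume "\<not> ?thesis"
    then have "(\<Sum>i\<in>UNIV \<inter> {..<N}. g i x) = 0" by (simp add: g_def)
    then have "h x \<le> 2 * (1/2)^N" using subsum_tail[of N g x UNIV] g(2) by (simp add: h_def)
    then show False using hM[OF x] N by linarith
  qed
  then have ex: "\<exists>i<N. s i x \<noteq> 0 \<and> (\<exists>U\<in>\<U>. \<forall>y\<in>topspace X - U. s i y = 0)" if x: "x \<in> S" for x
    using that sF unfolding F_def by blast
  define W where "W i = (SOME U. U \<in> \<U> \<and> (\<forall>y\<in>topspace X - U. s i y = 0))" for i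
  define I where "I = {i. i < N \<and> (\<exists>U\<in>\<U>. \<forall>y\<in>topspace X - U. s i y = 0)}"
  have W: "W i \<in> \<U> \<and> (\<forall>y\<in>topspace X - W i. s i y = 0)" if "i \<in> I" for i
    unfolding W_def by (rule someI_ex) (use that in \<open>auto simp: I_def\<close>)
  show "\<exists>\<F>. finite \<F> \<and> \<F> \<subseteq> \<U> \<and> S \<subseteq> \<Union>\<F>"
  proof (intro exI conjI)
    show "finite (W ` I)" by (simp add: I_def)
    show "W ` I \<subseteq> \<U>" using W by blast
    show "S \<subseteq> \<Union>(W ` I)"
    proof
      fix x assume x: "x \<in> S"
      obtain i where i: "i \<in> I" "s i x \<noteq> 0" using ex[OF x] by (auto simp: I_def)
      then show "x \<in> \<Union>(W ` I)" using W[OF i(1)] x closedin_subset[OF S] by blast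
    qed
  qed
qed

text \<open>The ideal contains every function that vanishes off the zero set of a function \<open>\<phi>\<close> without
  zeros on the support. To see this, make \<open>\<phi>\<^sup>2\<close> invertible by adding a member of the
  ideal. By the Lindelof property countably many members of the ideal have, together with \<open>\<phi>\<close>,
  no common zero; \<open>w i\<close> adds the squares of the first \<open>i\<close> to \<open>\<phi>\<^sup>2\<close>. The sets where \<open>w i\<close> is
  at most \<open>1 / i\<close> are locally finite, so a bump \<open>h i\<close> living there belongs to the ideal
  for some \<open>i\<close>, and \<open>h i + w i\<close> is the required invertible function.\<close>

lemma annihilator_in_barrel_ideal:
  assumes L: "Lindelof_space X" and B: "barrel X B" and \<phi>: "\<phi> \<in> continuous_functions X"
    and \<phi>S: "\<And>x. x \<in> barrel_support X B \<Longrightarrow> \<phi> x \<noteq> 0"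
    and g: "g \<in> continuous_functions X" "g * \<phi> = 0"
  shows "g \<in> barrel_ideal X B"
proof -
  let ?I = "barrel_ideal X B"
  have "\<exists>u\<in>insert \<phi> ?I. u x \<noteq> 0" if "x \<in> topspace X" for x
    using \<phi>S[of x] that by (auto simp: barrel_support_def)
  then obtain s where s: "range s \<subseteq> insert \<phi> ?I" and nz: "\<And>x. x \<in> topspace X \<Longrightarrow> \<exists>i::nat. s i x \<noteq> 0"
    using Lindelof_nonvanishing_sequence[OF L, of "insert \<phi> ?I"] barrel_ideal_subset[OF B] \<phi> by auto
  define u where "u i = (if s i \<in> ?I then s i else 0)" for i
  have uI: "u i \<in> ?I" for i by (simp add: u_def barrel_ideal_zero[OF B])
  have uC: "u i \<in> continuous_functions X" for i using uI barrel_ideal_subset[OF B] by blast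
  define v where "v i = (\<Sum>j<i. u j * u j)" for i
  have vI: "v i \<in> ?I" for i
    unfolding v_def by (intro barrel_ideal_sum[OF B] barrel_ideal_mult[OF B] uI uC) simp
  define w where "w i = v i + \<phi> * \<phi>" for i
  have wC: "w i \<in> continuous_functions X" for i
    unfolding w_def using vI barrel_ideal_subset[OF B] \<phi> by (auto intro!: continuous_functions_add continuous_functions_mult)
  have wc: "continuous_map X euclideanreal (w i)" for i by (rule continuous_functionsD(1)[OF wC])
  have w_eq: "w i x = (\<Sum>j<i. (u j x)\<^sup>2) + (\<phi> x)\<^sup>2" for i x
    by (simp add: w_def v_def sum_fun_apply power2_eq_square)
  have w0: "0 \<le> w i x" for i x unfolding w_eq by (intro add_nonneg_nonneg sum_nonneg) auto
  have wmono: "w i x \<le> w j x" if "i \<le> j" for i j x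
    unfolding w_eq using that by (intro add_right_mono sum_mono2) auto
  have wpos: "\<exists>i. w i x > 0" if x: "x \<in> topspace X" for x
  proof -
    obtain i where i: "s i x \<noteq> 0" using nz[OF x] by blast
    have "w (Suc i) x \<noteq> 0"
    proof
      assume "w (Suc i) x = 0"
      then have "(u i x)\<^sup>2 + (\<phi> x)\<^sup>2 \<le> 0"
        using w0[of i x] unfolding w_eq by (simp add: sum_nonneg add.assoc) (smt (verit) sum_nonneg zero_le_power2)
      then have "u i x = 0" "\<phi> x = 0" by (smt (verit) power2_less_eq_zero_iff zero_le_power2)+
      moreover have "s i \<in> insert \<phi> ?I" using s by blast
      ultimately show False using i by (auto simp: u_def split: if_splits)
    qed
    then show ?thesis using w0[of "Suc i" x] by (intro exI[of _ "Suc i"]) simp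
  qed
  define h where "h i = zero_extension X (\<lambda>x. max 0 (1 - real i * w i x))" for i
  have hC: "h i \<in> continuous_functions X" for i
    unfolding h_def
    by (intro zero_extension_continuous_functions continuous_real_compose[OF wc]) (intro continuous_intros)
  have "\<exists>i. h i \<in> ?I"
  proof (rule locally_finite_meets_barrel_ideal[OF B hC])
    show "openin X {x \<in> topspace X. w i x \<in> {y. real i * y > 1}}" for i
      by (intro openin_real_preimage[OF wc] open_Collect_less continuous_intros)
    show "topspace X \<subseteq> (\<Union>i. {x \<in> topspace X. w i x \<in> {y. real i * y > 1}})"
    proof
      fix x assume x: "x \<in> topspace X"
      obtain i where i: "w i x > 0" using wpos[OF x] by blast
      obtain n where n: "1 / w i x < real n" using reals_Archimedean2 by blast
      have "1 < real n * w i x" using n i by (simp add: field_simps)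
      also have "\<dots> \<le> real (max i n) * w (max i n) x"
        using w0 wmono by (intro mult_mono) auto
      finally show "x \<in> (\<Union>i. {x \<in> topspace X. w i x \<in> {y. real i * y > 1}})" using x by blast
    qed
    show "h j x = 0" if ij: "i \<le> j" and x: "x \<in> {x \<in> topspace X. w i x \<in> {y. real i * y > 1}}" for i j x
    proof -
      have "real i * w i x \<le> real j * w j x" using w0 wmono[OF ij] ij by (intro mult_mono) auto
      then show ?thesis using x by (auto simp: h_def)
    qed
  qed
  then obtain i where i: "h i \<in> ?I" by blast
  \<comment> \<open>since \<open>g * \<phi> = 0\<close>, multiplying \<open>q\<close> by \<open>h i + w i\<close> or by its part in the ideal makes no difference\<close>
  define q where "q = zero_extension X (\<lambda>x. g x / (h i x + w i x))"
  have hw: "h i x + w i x > 0" if "x \<in> topspace X" for x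
    using that w0[of i x] by (cases "w i x = 0") (auto simp: h_def max_def)
  have "q \<in> continuous_functions X"
    unfolding q_def using hw
    by (intro zero_extension_continuous_functions continuous_map_real_divide continuous_map_add
        continuous_functionsD(1)[OF hC] continuous_functionsD(1)[OF wC] continuous_functionsD(1)[OF g(1)]) force
  moreover have "g = q * (h i + v i)"
  proof
    fix x
    show "g x = (q * (h i + v i)) x"
    proof (cases "x \<in> topspace X")
      case True
      have "g x * \<phi> x = 0" using fun_cong[OF g(2), of x] by simp
      then have eq: "g x * (h i x + v i x) = g x * (h i x + w i x)"
        by (simp add: w_def algebra_simps)
      have "(q * (h i + v i)) x = g x * (h i x + v i x) / (h i x + w i x)"
        using True by (simp add: q_def)
      then show ?thesis unfolding eq using hw[OF True] by simp
    next
      case False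
      then show ?thesis using continuous_functionsD(2)[OF g(1)] by (simp add: q_def)
    qed
  qed
  ultimately show ?thesis
    using barrel_ideal_mult[OF B barrel_ideal_add[OF B i vI]] by metis
qed

text \<open>Take as compact set the support, which is closed and on which all continuous functions
  are bounded. A function that is small on it splits into its truncation, which lies in the
  uniform ball inside the barrel, and a rest that vanishes near the support, which lies in the ideal.\<close>

proposition Lindelof_Ck_barrelled:
  assumes X: "tychonoff_space X" and L: "Lindelof_space X" and B: "barrel X B"
  shows "\<exists>K e. compactin X K \<and> e > 0 \<and> uniform_ball X K e 0 \<subseteq> B"
proof -
  let ?S = "barrel_support X B"
  obtain \<delta> where \<delta>: "\<delta> > 0" "\<And>f. f \<in> continuous_functions X \<Longrightarrow> (\<And>x. \<bar>f x\<bar> \<le> \<delta>) \<Longrightarrow> f \<in> B"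
    using barrel_contains_sup_ball[OF B] by blast
  define e where "e = \<delta> / 4"
  have e: "e > 0" using \<delta>(1) by (simp add: e_def)
  have "g \<in> B" if gb: "g \<in> uniform_ball X ?S e 0" for g
  proof -
    have g: "g \<in> continuous_functions X" and gS: "\<And>x. x \<in> ?S \<Longrightarrow> \<bar>g x\<bar> < e"
      using gb by (auto simp: uniform_ball_def)
    have gc: "continuous_map X euclideanreal g" by (rule continuous_functionsD(1)[OF g])
    define c where "c = zero_extension X (\<lambda>x. max (- 2 * e) (min (2 * e) (g x)))"
    define \<phi> where "\<phi> = zero_extension X (\<lambda>x. max 0 (2 * e - \<bar>g x\<bar>))"
    have cC: "c \<in> continuous_functions X" and \<phi>C: "\<phi> \<in> continuous_functions X"
      unfolding c_def \<phi>_def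
      by (intro zero_extension_continuous_functions continuous_real_compose[OF gc]; intro continuous_intros)+
    have "2 *\<^sub>R c \<in> B"
      by (rule \<delta>(2)[OF continuous_functions_scale[OF cC]]) (use e in \<open>auto simp: c_def zero_extension_def e_def abs_if max_def min_def\<close>)
    moreover have "g - c \<in> barrel_ideal X B"
    proof (rule annihilator_in_barrel_ideal[OF L B \<phi>C _ continuous_functions_diff[OF g cC]])
      show "\<phi> x \<noteq> 0" if "x \<in> ?S" for x
        using gS[OF that] that e by (auto simp: \<phi>_def barrel_support_def max_def)
      show "(g - c) * \<phi> = 0"
        by (auto simp: fun_eq_iff c_def \<phi>_def zero_extension_def max_def min_def)
    qed
    then have "2 *\<^sub>R (g - c) \<in> B" by (rule barrel_ideal_scale_in_barrel[OF B])
    ultimately have "c + (g - c) \<in> B" by (rule barrel_midpoint[OF B])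
    then show ?thesis by simp
  qed
  moreover have "compactin X ?S"
    by (rule Lindelof_closed_bounding_imp_compactin[OF X L closedin_barrel_support[OF B] barrel_support_bounding[OF B]])
  ultimately show ?thesis using e by blast
qed

section \<open>Polishability of the pointwise topology\<close>

text \<open>A network is a base whose members need not be open. For each of its members inside some member
  of the cover, one such member of the cover suffices.\<close>

lemma countable_network_imp_Lindelof:
  assumes N: "countable \<N>" "\<And>A. A \<in> \<N> \<Longrightarrow> A \<subseteq> topspace X"
    and net: "\<And>W x. openin X W \<Longrightarrow> x \<in> W \<Longrightarrow> \<exists>A\<in>\<N>. x \<in> A \<and> A \<subseteq> W"
  shows "Lindelof_space X"
  unfolding Lindelof_space_def
proof (intro allI impI)
  fix \<U> assume U: "(\<forall>U\<in>\<U>. openin X U) \<and> \<Union>\<U> = topspace X"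
  define \<A> where "\<A> = {A \<in> \<N>. \<exists>U\<in>\<U>. A \<subseteq> U}"
  define c where "c A = (SOME U. U \<in> \<U> \<and> A \<subseteq> U)" for A
  have c: "c A \<in> \<U> \<and> A \<subseteq> c A" if "A \<in> \<A>" for A
    unfolding c_def by (rule someI_ex) (use that in \<open>auto simp: \<A>_def\<close>)
  have "x \<in> \<Union>(c ` \<A>)" if x: "x \<in> topspace X" for x
  proof -
    obtain U where u: "U \<in> \<U>" "x \<in> U" using U x by blast
    then obtain A where "A \<in> \<N>" "x \<in> A" "A \<subseteq> U" using net[of U x] U by blast
    then have "A \<in> \<A>" "x \<in> A" using u by (auto simp: \<A>_def)
    then show ?thesis using c by blast
  qed
  moreover have "\<Union>(c ` \<A>) \<subseteq> topspace X" using c U by blast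
  moreover have "countable (c ` \<A>)" using N(1) by (auto simp: \<A>_def)
  moreover have "c ` \<A> \<subseteq> \<U>" using c by blast
  ultimately show "\<exists>\<V>. countable \<V> \<and> \<V> \<subseteq> \<U> \<and> \<Union>\<V> = topspace X"
    by (intro exI[of _ "c ` \<A>"]) blast
qed

locale frechet_finer_than_Cp =
  fixes X :: "'a topology" and T :: "('a \<Rightarrow> real) topology"
  assumes tychonoff: "tychonoff_space X"
    and topspace_T: "topspace T = continuous_functions X"
    and finer: "openin (Cp X) U \<Longrightarrow> openin T U"
    and frechet: "frechet_space T"
    and separable: "separable_space T"
begin

lemma continuous_evaluation: "continuous_map T euclideanreal (\<lambda>f. f x)"
proof -
  have "continuous_map T (Cp X) id"
    unfolding continuous_map_def
  proof (intro conjI allI impI)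
    fix U assume U: "openin (Cp X) U"
    then have "{f \<in> topspace T. id f \<in> U} = U"
      using openin_subset[OF U] topspace_T by auto
    then show "openin T {f \<in> topspace T. id f \<in> U}" using finer[OF U] by simp
  qed (simp add: topspace_T)
  from continuous_map_compose[OF this continuous_map_Cp_apply[of X x]] show ?thesis by (simp add: o_def)
qed

lemma continuous_scale_translate:
  assumes h: "h \<in> continuous_functions X"
  shows "continuous_map T T (\<lambda>f. h + c *\<^sub>R f)"
proof -
  have add: "continuous_map (prod_topology T T) T (\<lambda>(x, y). x + y)"
    and scale: "continuous_map (prod_topology euclideanreal T) T (\<lambda>(c, x). c *\<^sub>R x)"
    using frechet by (simp_all add: frechet_space_def locally_convex_space_def topological_vector_space_def)
  have "continuous_map T (prod_topology euclideanreal T) (\<lambda>f. (c, f))"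
    by (simp add: continuous_map_pairwise o_def)
  from continuous_map_compose[OF this scale] have "continuous_map T T (\<lambda>f. c *\<^sub>R f)"
    by (simp add: o_def)
  then have "continuous_map T (prod_topology T T) (\<lambda>f. (h, c *\<^sub>R f))"
    using h topspace_T by (simp add: continuous_map_pairwise o_def)
  from continuous_map_compose[OF this add] show ?thesis by (simp add: o_def)
qed

lemma openin_scale_translate:
  assumes "openin T U" "h \<in> continuous_functions X"
  shows "openin T {f \<in> continuous_functions X. h + c *\<^sub>R f \<in> U}"
  using openin_continuous_map_preimage[OF continuous_scale_translate[OF assms(2)] assms(1)] topspace_T
  by simp

lemma neighbourhood_absorbing:
  assumes U: "openin T U" "0 \<in> U" and f: "f \<in> continuous_functions X"
  shows "\<exists>t>0. t *\<^sub>R f \<in> U"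
proof -
  have scale: "continuous_map (prod_topology euclideanreal T) T (\<lambda>(c, x). c *\<^sub>R x)"
    using frechet by (simp add: frechet_space_def locally_convex_space_def topological_vector_space_def)
  have "continuous_map euclideanreal (prod_topology euclideanreal T) (\<lambda>c. (c, f))"
    using f topspace_T by (simp add: continuous_map_pairwise o_def)
  from continuous_map_compose[OF this scale] have "continuous_map euclideanreal T (\<lambda>c. c *\<^sub>R f)"
    by (simp add: o_def)
  from openin_continuous_map_preimage[OF this U(1)] have "open {c. c *\<^sub>R f \<in> U}" by simp
  moreover have "0 \<in> {c. c *\<^sub>R f \<in> U}" using U(2) by simp
  ultimately have "\<exists>e>0. cball 0 e \<subseteq> {c. c *\<^sub>R f \<in> U}"
    by (rule open_contains_cball[THEN iffD1, THEN bspec])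
  then obtain e where e: "e > 0" "cball 0 e \<subseteq> {c. c *\<^sub>R f \<in> U}" by (elim exE conjE)
  have "e \<in> cball 0 e" using e(1) by simp
  then have "e *\<^sub>R f \<in> U" using e(2) by (simp add: subset_iff)
  then show ?thesis using e(1) by blast
qed

definition metric_T :: "('a \<Rightarrow> real) \<Rightarrow> ('a \<Rightarrow> real) \<Rightarrow> real" where
  "metric_T = (SOME d. Metric_space (topspace T) d \<and> Metric_space.mtopology (topspace T) d = T \<and>
     Metric_space.mcomplete (topspace T) d \<and>
     (\<forall>x\<in>topspace T. \<forall>y\<in>topspace T. \<forall>z\<in>topspace T. d (x + z) (y + z) = d x y))"

lemma metric_T:
  shows "Metric_space (continuous_functions X) metric_T"
    and "Metric_space.mtopology (continuous_functions X) metric_T = T"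
    and "Metric_space.mcomplete (continuous_functions X) metric_T"
    and "x \<in> continuous_functions X \<Longrightarrow> y \<in> continuous_functions X \<Longrightarrow> z \<in> continuous_functions X \<Longrightarrow>
      metric_T (x + z) (y + z) = metric_T x y"
proof -
  have "\<exists>d. Metric_space (topspace T) d \<and> Metric_space.mtopology (topspace T) d = T \<and>
     Metric_space.mcomplete (topspace T) d \<and>
     (\<forall>x\<in>topspace T. \<forall>y\<in>topspace T. \<forall>z\<in>topspace T. d (x + z) (y + z) = d x y)"
    using frechet unfolding frechet_space_def by (rule conjunct2)
  from someI_ex[OF this]
  have *: "Metric_space (topspace T) metric_T \<and> Metric_space.mtopology (topspace T) metric_T = T \<and>
     Metric_space.mcomplete (topspace T) metric_T \<and>
     (\<forall>x\<in>topspace T. \<forall>y\<in>topspace T. \<forall>z\<in>topspace T. metric_T (x + z) (y + z) = metric_T x y)"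
    unfolding metric_T_def[symmetric] .
  show "Metric_space (continuous_functions X) metric_T"
    "Metric_space.mtopology (continuous_functions X) metric_T = T"
    "Metric_space.mcomplete (continuous_functions X) metric_T"
    using * unfolding topspace_T by blast+
  show "x \<in> continuous_functions X \<Longrightarrow> y \<in> continuous_functions X \<Longrightarrow> z \<in> continuous_functions X \<Longrightarrow>
      metric_T (x + z) (y + z) = metric_T x y"
    using * unfolding topspace_T by blast
qed

sublocale M: Metric_space "continuous_functions X" metric_T
  by (rule metric_T(1))

lemma metric_T_add: 
  assumes "f \<in> continuous_functions X" "u \<in> continuous_functions X"
  shows "metric_T f (f + u) = metric_T 0 u"
  using metric_T(4)[OF continuous_functions_zero assms(2,1)] by (simp add: add.commute)

lemma small_symmetric_convex_neighbourhood:
  assumes e: "e > 0"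
  shows "\<exists>U. openin T U \<and> convex U \<and> 0 \<in> U \<and> (\<forall>f\<in>U. - f \<in> U) \<and> (\<forall>f\<in>U. metric_T 0 f < e)"
proof -
  have "openin T (M.mball 0 e)" "0 \<in> M.mball 0 e"
    using M.openin_mball[of 0 e] e continuous_functions_zero[of X] by (simp_all add: metric_T(2))
  then obtain V where V: "openin T V" "convex V" "0 \<in> V" "V \<subseteq> M.mball 0 e"
    using frechet unfolding frechet_space_def locally_convex_space_def by blast
  define U where "U = V \<inter> {f \<in> continuous_functions X. 0 + (-1) *\<^sub>R f \<in> V}"
  have "openin T U"
    unfolding U_def by (intro openin_Int V(1) openin_scale_translate continuous_functions_zero)
  moreover have "convex U"
  proof (rule convexI)
    fix f g and a b :: real assume fg: "f \<in> U" "g \<in> U" and ab: "0 \<le> a" "0 \<le> b" "a + b = 1"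
    have "a *\<^sub>R f + b *\<^sub>R g \<in> V" using fg ab V(2) by (auto simp: U_def intro: convexD)
    moreover have "a *\<^sub>R (- f) + b *\<^sub>R (- g) \<in> V" using fg ab V(2) by (intro convexD) (auto simp: U_def)
    moreover have "- (a *\<^sub>R f + b *\<^sub>R g) = a *\<^sub>R (- f) + b *\<^sub>R (- g)" by simp
    moreover have "a *\<^sub>R f + b *\<^sub>R g \<in> continuous_functions X"
      using fg by (auto simp: U_def intro!: continuous_functions_add continuous_functions_scale)
    ultimately show "a *\<^sub>R f + b *\<^sub>R g \<in> U" by (simp add: U_def)
  qed
  moreover have "0 \<in> U" using V(3) continuous_functions_zero by (simp add: U_def)
  moreover have "\<forall>f\<in>U. - f \<in> U" by (auto simp: U_def continuous_functions_uminus)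
  moreover have "\<forall>f\<in>U. metric_T 0 f < e" using V(4) by (auto simp: U_def)
  ultimately show ?thesis by blast
qed

text \<open>One sequence of neighbourhoods, fixed once and for all, with diameters small enough for
  increments from them to be summable.\<close>

definition nbhd :: "nat \<Rightarrow> ('a \<Rightarrow> real) set" where
  "nbhd n = (SOME U. openin T U \<and> convex U \<and> 0 \<in> U \<and> (\<forall>f\<in>U. - f \<in> U) \<and>
     (\<forall>f\<in>U. metric_T 0 f < (1/2)^n))"

lemma nbhd: "openin T (nbhd n)" "convex (nbhd n)" "0 \<in> nbhd n" "f \<in> nbhd n \<Longrightarrow> - f \<in> nbhd n"
  "f \<in> nbhd n \<Longrightarrow> metric_T 0 f < (1/2)^n"
  using someI_ex[OF small_symmetric_convex_neighbourhood[of "(1/2)^n"]] unfolding nbhd_def by simp_all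

lemma nbhd_subset: "nbhd n \<subseteq> continuous_functions X"
  using openin_subset[OF nbhd(1)] topspace_T by simp

lemma nbhd_base:
  assumes "openin T U" "0 \<in> U"
  shows "\<exists>n. nbhd n \<subseteq> U"
proof -
  obtain r where r: "r > 0" "M.mball 0 r \<subseteq> U"
    using assms M.openin_mtopology[of U] metric_T(2) by auto
  obtain n where "(1/2::real)^n < r" using real_arch_pow_inv[OF r(1), of "1/2"] by auto
  then have "nbhd n \<subseteq> M.mball 0 r"
    using nbhd(5)[of _ n] nbhd_subset[of n] continuous_functions_zero by fastforce
  then show ?thesis using r(2) by blast
qed

definition polar :: "nat \<Rightarrow> 'a set" where
  "polar n = {x \<in> topspace X. \<forall>f\<in>nbhd n. \<bar>f x\<bar> \<le> 1}"

text \<open>The theorem of Banach and Steinhaus for the evaluations at the points of \<open>C\<close>, which are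
  pointwise bounded since continuous functions are bounded on \<open>C\<close>.\<close>

lemma compactin_subset_polar:
  assumes C: "compactin X C"
  shows "\<exists>n. C \<subseteq> polar n"
proof -
  define A where "A m = {f \<in> continuous_functions X. \<forall>x\<in>C. \<bar>f x\<bar> \<le> real m}" for m
  have "closedin T (A m)" for m
  proof -
    have "A m = topspace T \<inter> (\<Inter>x\<in>C. {f \<in> topspace T. f x \<in> {y. \<bar>y\<bar> \<le> real m}})"
      by (auto simp: A_def topspace_T)
    moreover have "closedin T {f \<in> topspace T. f x \<in> {y. \<bar>y\<bar> \<le> real m}}" for x
      by (intro closedin_real_preimage continuous_evaluation closed_Collect_le continuous_intros)
    then have "closedin T (topspace T \<inter> (\<Inter>x\<in>C. {f \<in> topspace T. f x \<in> {y. \<bar>y\<bar> \<le> real m}}))"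
      by (cases "C = {}") (auto intro!: closedin_Int closedin_Inter simp del: mem_Collect_eq)
    ultimately show ?thesis by simp
  qed
  moreover have "T interior_of \<Union>(range A) \<noteq> {}"
  proof -
    have "\<exists>m. f \<in> A m" if f: "f \<in> continuous_functions X" for f
    proof -
      obtain M where "\<forall>x\<in>C. \<bar>f x\<bar> \<le> M" using bounded_on_compactin[OF f C] by blast
      moreover obtain m where "M \<le> real m" using real_arch_simple by blast
      ultimately show ?thesis using f by (intro exI[of _ m]) (force simp: A_def)
    qed
    then have "\<Union>(range A) = topspace T" by (auto simp: A_def topspace_T)
    then show ?thesis using continuous_functions_zero[of X] topspace_T interior_of_topspace[of T] by auto
  qed
  moreover have "T interior_of \<Union>(range A) = {}" if "\<And>m. closedin T (A m)" "\<And>m. T interior_of A m = {}"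
    using M.metric_Baire_category_alt[OF metric_T(3), of "range A"] that unfolding metric_T(2) by auto
  ultimately have "\<exists>m. T interior_of A m \<noteq> {}" by meson
  then obtain m h where h: "h \<in> T interior_of A m" by blast
  have hA: "h \<in> A m" using h interior_of_subset by fast
  have hC: "h \<in> continuous_functions X" using hA by (simp add: A_def)
  \<comment> \<open>the difference of two members of \<open>A m\<close> is at most \<open>2 * m\<close>; adding \<open>1\<close> keeps \<open>c\<close> positive for \<open>m = 0\<close>\<close>
  define c where "c = 2 * real m + 1"
  define U where "U = {f \<in> continuous_functions X. h + c *\<^sub>R f \<in> T interior_of A m}"
  have "openin T U" unfolding U_def by (intro openin_scale_translate hC) simp
  moreover have "0 \<in> U" using h continuous_functions_zero by (simp add: U_def)
  ultimately obtain n where n: "nbhd n \<subseteq> U" using nbhd_base by blast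
  have "\<bar>f x\<bar> \<le> 1" if f: "f \<in> nbhd n" and x: "x \<in> C" for f x
  proof -
    have "h + c *\<^sub>R f \<in> A m" using f n interior_of_subset[of T "A m"] by (auto simp: U_def)
    then have "\<bar>h x + c * f x\<bar> \<le> real m" "\<bar>h x\<bar> \<le> real m" using x hA by (auto simp: A_def)
    then have "\<bar>c * f x\<bar> \<le> c" unfolding c_def by linarith
    moreover have "c > 0" by (simp add: c_def)
    ultimately show ?thesis by (simp add: abs_mult)
  qed
  then have "C \<subseteq> polar n" using compactin_subset_topspace[OF C] by (auto simp: polar_def)
  then show ?thesis by blast
qed

lemma closedin_polar: "closedin X (polar n)"
proof -
  have "polar n = (\<Inter>f\<in>nbhd n. {x \<in> topspace X. f x \<in> {-1..1}})"
    using nbhd(3)[of n] by (auto simp: polar_def abs_le_iff)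
  moreover have "closedin X {x \<in> topspace X. f x \<in> {-1..1}}" if "f \<in> nbhd n" for f
    using that nbhd_subset continuous_functionsD(1) by (intro closedin_real_preimage) auto
  ultimately show ?thesis using nbhd(3)[of n] by (simp only:) (intro closedin_Inter, auto)
qed

lemma polar_bounding:
  assumes f: "f \<in> continuous_functions X"
  shows "\<exists>M. \<forall>x\<in>polar n. \<bar>f x\<bar> \<le> M"
proof -
  obtain t where t: "t > 0" "t *\<^sub>R f \<in> nbhd n"
    using neighbourhood_absorbing[OF nbhd(1,3) f] by blast
  have "\<bar>f x\<bar> \<le> 1 / t" if "x \<in> polar n" for x
  proof -
    have "\<bar>t * f x\<bar> \<le> 1" using that t(2) by (auto simp: polar_def)
    then show ?thesis using t(1) by (simp add: abs_mult field_simps)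
  qed
  then show ?thesis by blast
qed

text \<open>On a polar, every continuous function is uniformly approximated by members of the dense set
  \<open>D\<close>. The parts of the polars where a member of \<open>D\<close> exceeds \<open>1/2\<close> therefore form a countable network.\<close>

lemma Lindelof: "Lindelof_space X"
proof -
  obtain D where D: "countable D" "D \<subseteq> topspace T" "T closure_of D = topspace T"
    using separable unfolding separable_space_def by blast
  define A where "A p = {x \<in> polar (fst p). snd p x > 1/2}" for p :: "nat \<times> ('a \<Rightarrow> real)"
  show ?thesis
  proof (rule countable_network_imp_Lindelof[of "A ` (UNIV \<times> D)"])
    show "countable (A ` (UNIV \<times> D))" using D(1) by simp
    show "S \<subseteq> topspace X" if "S \<in> A ` (UNIV \<times> D)" for S
      using that by (auto simp: A_def polar_def)
    fix W x assume W: "openin X W" "x \<in> W"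
    have x: "x \<in> topspace X" using W openin_subset by blast
    obtain n where n: "x \<in> polar n"
      using compactin_subset_polar[of "{x}"] x by auto
    obtain f where f: "f \<in> continuous_functions X" "f x = 1" "\<forall>y\<in>topspace X - W. f y = 0"
      using tychonoff_space_separation[OF tychonoff, of "topspace X - W" x] W x by auto
    define U where "U = {g \<in> continuous_functions X. (-4) *\<^sub>R f + 4 *\<^sub>R g \<in> nbhd n}"
    have "openin T U"
      unfolding U_def by (intro openin_scale_translate nbhd(1) continuous_functions_scale f(1))
    moreover have "f \<in> U"
      using f(1) nbhd(3) by (simp add: U_def scaleR_left_distrib[symmetric])
    moreover have "f \<in> T closure_of D" using D(3) f(1) topspace_T by simp
    ultimately obtain g where g: "g \<in> D" "g \<in> U" by (meson in_closure_of)
    have close: "\<bar>f y - g y\<bar> \<le> 1/4" if y: "y \<in> polar n" for y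
    proof -
      have "\<bar>((-4) *\<^sub>R f + 4 *\<^sub>R g) y\<bar> \<le> 1" using g(2) y by (auto simp: U_def polar_def)
      then have "\<bar>4 * g y - 4 * f y\<bar> \<le> 1" by simp
      then show ?thesis by linarith
    qed
    have "x \<in> A (n, g)" using close[OF n] n f(2) by (simp add: A_def abs_if split: if_splits)
    moreover have "A (n, g) \<subseteq> W"
    proof
      fix y assume y: "y \<in> A (n, g)"
      then have "y \<in> polar n" "g y > 1/2" by (simp_all add: A_def)
      then have "f y \<noteq> 0" using close[of y] by auto
      then show "y \<in> W" using f(3) \<open>y \<in> polar n\<close> by (auto simp: polar_def)
    qed
    ultimately show "\<exists>S\<in>A ` (UNIV \<times> D). x \<in> S \<and> S \<subseteq> W" using g(1) by blast
  qed
qed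

lemma hemicompact: "hemicompact_space X"
  unfolding hemicompact_space_def
proof (intro exI conjI ballI allI impI)
  show "countable (range polar)" by simp
  show "compactin X K" if "K \<in> range polar" for K
    using that Lindelof_closed_bounding_imp_compactin[OF tychonoff Lindelof closedin_polar polar_bounding] by blast
  show "\<exists>K\<in>range polar. C \<subseteq> K" if "compactin X C" for C
    using compactin_subset_polar[OF that] by blast
qed

text \<open>The neighbourhood itself need not be closed in the compact-open topology; the closure keeps it
  convex, symmetric and absorbing.\<close>

lemma barrel_closure_nbhd: "barrel X (Ck X closure_of nbhd n)"
proof -
  let ?B = "Ck X closure_of nbhd n"
  have in_B: "f \<in> ?B \<longleftrightarrow> f \<in> continuous_functions X \<and>
      (\<forall>K e. compactin X K \<and> e > 0 \<longrightarrow> (\<exists>u\<in>nbhd n. u \<in> uniform_ball X K e f))" (is "_ \<longleftrightarrow> ?R f") for f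
  proof
    assume f: "f \<in> ?B"
    then have fC: "f \<in> continuous_functions X" by (simp add: in_closure_of)
    have "\<exists>u\<in>nbhd n. u \<in> uniform_ball X K e f" if "compactin X K" "e > 0" for K e
    proof -
      have "f \<in> uniform_ball X K e f" using fC that(2) by (simp add: uniform_ball_def)
      then show ?thesis using f openin_uniform_ball[OF fC that(1)] unfolding in_closure_of by blast
    qed
    then show "?R f" using fC by blast
  next
    assume f: "?R f"
    show "f \<in> ?B"
      unfolding in_closure_of
    proof (intro conjI allI impI)
      fix U assume "f \<in> U \<and> openin (Ck X) U"
      then obtain K e where K: "compactin X K" "e > 0" "uniform_ball X K e f \<subseteq> U"
        using openin_CkD by blast
      then obtain u where "u \<in> nbhd n" "u \<in> uniform_ball X K e f" using f by blast
      then show "\<exists>y. y \<in> nbhd n \<and> y \<in> U" using K(3) by blast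
    qed (use f in simp)
  qed
  show ?thesis
    unfolding barrel_def
  proof (intro conjI ballI)
    show "closedin (Ck X) ?B" by simp
    show "convex ?B"
    proof (rule convexI)
      fix f g and a b :: real assume f: "f \<in> ?B" and g: "g \<in> ?B" and ab: "0 \<le> a" "0 \<le> b" "a + b = 1"
      have "\<exists>w\<in>nbhd n. w \<in> uniform_ball X K e (a *\<^sub>R f + b *\<^sub>R g)" if K: "compactin X K" "e > 0" for K e
      proof -
        obtain u v where uv: "u \<in> nbhd n" "u \<in> uniform_ball X K e f" "v \<in> nbhd n" "v \<in> uniform_ball X K e g"
          using f g K in_B by meson
        have "\<bar>(a *\<^sub>R u + b *\<^sub>R v) x - (a *\<^sub>R f + b *\<^sub>R g) x\<bar> < e" if x: "x \<in> K" for x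
        proof -
          have "u x - f x \<in> {-e<..<e}" "v x - g x \<in> {-e<..<e}"
            using uv x by (auto simp: uniform_ball_def abs_less_iff)
          then have "a *\<^sub>R (u x - f x) + b *\<^sub>R (v x - g x) \<in> {-e<..<e}" using ab by (intro convexD) auto
          moreover have "(a *\<^sub>R u + b *\<^sub>R v) x - (a *\<^sub>R f + b *\<^sub>R g) x = a *\<^sub>R (u x - f x) + b *\<^sub>R (v x - g x)"
            by (simp add: algebra_simps)
          ultimately show ?thesis by (auto simp: abs_less_iff)
        qed
        moreover have "a *\<^sub>R u + b *\<^sub>R v \<in> nbhd n" using uv ab nbhd(2) by (intro convexD) auto
        ultimately show ?thesis
          using nbhd_subset[of n] by (intro bexI[of _ "a *\<^sub>R u + b *\<^sub>R v"]) (auto simp: uniform_ball_def)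
      qed
      then show "a *\<^sub>R f + b *\<^sub>R g \<in> ?B"
        using f g in_B by (simp add: continuous_functions_add continuous_functions_scale)
    qed
    show "- f \<in> ?B" if f: "f \<in> ?B" for f
    proof -
      have "\<exists>w\<in>nbhd n. w \<in> uniform_ball X K e (- f)" if K: "compactin X K" "e > 0" for K e
      proof -
        obtain u where u: "u \<in> nbhd n" "u \<in> uniform_ball X K e f" using f K in_B by blast
        have "- u \<in> uniform_ball X K e (- f)"
          unfolding uniform_ball_def
        proof (intro CollectI conjI ballI)
          show "- u \<in> continuous_functions X" using u(2) by (simp add: uniform_ball_def continuous_functions_uminus)
          fix x assume "x \<in> K"
          then have "\<bar>u x - f x\<bar> < e" using u(2) by (simp add: uniform_ball_def)
          then show "\<bar>(- u) x - (- f) x\<bar> < e" by simp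
        qed
        then show ?thesis using nbhd(4)[OF u(1)] by blast
      qed
      then show ?thesis using f in_B by (simp add: continuous_functions_uminus)
    qed
    show "\<exists>t>0. t *\<^sub>R f \<in> ?B" if f: "f \<in> continuous_functions X" for f
    proof -
      have "nbhd n \<subseteq> ?B" using closure_of_subset[of "nbhd n" "Ck X"] nbhd_subset by simp
      then show ?thesis using neighbourhood_absorbing[OF nbhd(1,3) f] by blast
    qed
  qed
qed

lemma closure_nbhd_contains_uniform_ball:
  "\<exists>K e. compactin X K \<and> e > 0 \<and> uniform_ball X K e 0 \<subseteq> Ck X closure_of nbhd n"
  by (rule Lindelof_Ck_barrelled[OF tychonoff Lindelof barrel_closure_nbhd])

lemma increments_converge:
  assumes f: "\<And>n. f n \<in> continuous_functions X" and step: "\<And>n. f (Suc n) - f n \<in> nbhd n"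
  shows "\<exists>g\<in>continuous_functions X. \<forall>x. (\<lambda>n. f n x) \<longlonglongrightarrow> g x"
proof -
  have d: "metric_T (f n) (f (Suc n)) < (1/2)^n" for n
  proof -
    have "metric_T (f n) (f (Suc n)) = metric_T 0 (f (Suc n) - f n)"
      using metric_T_add[OF f continuous_functions_diff[OF f f], of n "Suc n" n] by simp
    then show ?thesis using nbhd(5)[OF step] by simp
  qed
  have far: "metric_T (f n) (f m) \<le> 2 * (1/2)^n - 2 * (1/2)^m" if "n \<le> m" for n m
    using that
  proof (induction m rule: dec_induct)
    case base
    show ?case using f by simp
  next
    case (step m)
    have "metric_T (f n) (f (Suc m)) \<le> metric_T (f n) (f m) + metric_T (f m) (f (Suc m))"
      using f by (intro M.triangle)
    then show ?case using step.IH d[of m] by simp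
  qed
  have "M.MCauchy f"
    unfolding M.MCauchy_def
  proof (intro conjI allI impI)
    show "range f \<subseteq> continuous_functions X" using f by blast
    fix e :: real assume "e > 0"
    then obtain N where N: "2 * (1/2::real)^N < e" using half_power_small[of e 0] by blast
    have *: "metric_T (f n) (f m) < e" if "N \<le> n" "n \<le> m" for n m
    proof -
      have "(1/2::real)^n \<le> (1/2)^N" using that by (intro power_decreasing) auto
      moreover have "(0::real) < (1/2)^m" by simp
      ultimately show ?thesis using far[OF that(2)] N by linarith
    qed
    have "metric_T (f n) (f m) < e" if "N \<le> n" "N \<le> m" for n m
      using *[of n m] *[of m n] that M.commute[of "f n" "f m"] by (cases "n \<le> m") auto
    then show "\<exists>N. \<forall>n n'. N \<le> n \<longrightarrow> N \<le> n' \<longrightarrow> metric_T (f n) (f n') < e" by blast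
  qed
  then obtain g where "limitin M.mtopology f g sequentially"
    using metric_T(3) unfolding M.mcomplete_def by blast
  then have g: "limitin T f g sequentially" by (simp add: metric_T(2))
  have "(\<lambda>n. f n x) \<longlonglongrightarrow> g x" for x
    using continuous_map_limit[OF continuous_evaluation g, of x] by (simp add: o_def)
  moreover have "g \<in> continuous_functions X" using limitin_topspace[OF g] topspace_T by simp
  ultimately show ?thesis by blast
qed

text \<open>Successive approximation as in the open mapping theorem. The \<open>n\<close>-th approximant is so close to
  \<open>f\<close> on a stage that its correction on the next stage lies in the compact-open closure of the \<open>n\<close>-th
  neighbourhood. An increment from the neighbourhood itself, near that correction, gives the next
  approximant. The increments are summable for the Frechet metric, and the limit is \<open>f\<close>.\<close>

lemma stagewise_imp_continuous:
  assumes "compact_exhaustion X K"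
  shows "compact_exhaustion.stagewise_continuous X K \<subseteq> continuous_functions X"
proof
  interpret compact_exhaustion X K by (rule assms)
  fix f assume f: "f \<in> stagewise_continuous"
  have creg: "completely_regular_space X" using tychonoff by (simp add: tychonoff_space_def)
  have "\<exists>m e. e > 0 \<and> uniform_ball X (K m) e 0 \<subseteq> Ck X closure_of nbhd n" for n
  proof -
    obtain C e where C: "compactin X C" "e > 0" "uniform_ball X C e 0 \<subseteq> Ck X closure_of nbhd n"
      using closure_nbhd_contains_uniform_ball by blast
    obtain m where "C \<subseteq> K m" using cofinal_stages[OF C(1)] by blast
    then show ?thesis using C uniform_ball_mono[of C "K m" e e] by blast
  qed
  then obtain m e where e: "\<And>n. e n > 0"
    and me: "\<And>n. uniform_ball X (K (m n)) (e n) 0 \<subseteq> Ck X closure_of nbhd n"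
    by metis
  define C where "C n = K (max n (m n))" for n
  \<comment> \<open>the second bound makes the approximants converge to \<open>f\<close>\<close>
  define \<epsilon> where "\<epsilon> n = min (e n) (1 / real (Suc n))" for n
  have \<epsilon>: "\<epsilon> n > 0" for n using e by (simp add: \<epsilon>_def)
  have ball: "uniform_ball X (C n) (\<epsilon> n) 0 \<subseteq> Ck X closure_of nbhd n" for n
  proof -
    have "K (m n) \<subseteq> C n" unfolding C_def using incseq_stages by (simp add: incseqD)
    then have "uniform_ball X (C n) (\<epsilon> n) 0 \<subseteq> uniform_ball X (K (m n)) (e n) 0"
      by (rule uniform_ball_mono) (simp add: \<epsilon>_def)
    then show ?thesis using me by blast
  qed
  define P where "P n g \<longleftrightarrow> g \<in> uniform_ball X (C n) (\<epsilon> n) f" for n g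
  have "\<exists>F. \<forall>n. P n (F n) \<and> F (Suc n) - F n \<in> nbhd n"
  proof (rule dependent_nat_choice)
    show "\<exists>g. P 0 g"
      using extend_from_stage[OF creg f, of "max 0 (m 0)"] \<epsilon>[of 0] by (auto simp: P_def uniform_ball_def C_def)
  next
    fix g n assume g: "P n g"
    then have gC: "g \<in> continuous_functions X" by (simp add: P_def uniform_ball_def)
    \<comment> \<open>a stage containing both \<open>C n\<close> and \<open>C (Suc n)\<close>\<close>
    obtain h where h: "h \<in> continuous_functions X" "\<And>x. x \<in> K (max (max n (m n)) (max (Suc n) (m (Suc n)))) \<Longrightarrow> h x = f x"
      using extend_from_stage[OF creg f] by blast
    have CK: "C n \<subseteq> K (max (max n (m n)) (max (Suc n) (m (Suc n))))"
      "C (Suc n) \<subseteq> K (max (max n (m n)) (max (Suc n) (m (Suc n))))"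
      unfolding C_def by (rule incseqD[OF incseq_stages], simp)+
    have "h - g \<in> uniform_ball X (C n) (\<epsilon> n) 0"
      unfolding uniform_ball_def
    proof (intro CollectI conjI ballI)
      show "h - g \<in> continuous_functions X" by (rule continuous_functions_diff[OF h(1) gC])
      fix x assume x: "x \<in> C n"
      have "h x = f x" using x CK(1) h(2) by blast
      moreover have "\<bar>g x - f x\<bar> < \<epsilon> n" using g x by (simp add: P_def uniform_ball_def)
      ultimately show "\<bar>(h - g) x - 0 x\<bar> < \<epsilon> n" by simp
    qed
    then have "h - g \<in> Ck X closure_of nbhd n" using ball by blast
    moreover have "openin (Ck X) (uniform_ball X (C (Suc n)) (\<epsilon> (Suc n)) (h - g))"
      unfolding C_def by (intro openin_uniform_ball compactin_stage continuous_functions_diff h(1) gC)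
    moreover have "h - g \<in> uniform_ball X (C (Suc n)) (\<epsilon> (Suc n)) (h - g)"
      using \<epsilon>[of "Suc n"] continuous_functions_diff[OF h(1) gC] by (simp add: uniform_ball_def)
    ultimately obtain u where u: "u \<in> nbhd n" "u \<in> uniform_ball X (C (Suc n)) (\<epsilon> (Suc n)) (h - g)"
      unfolding in_closure_of by blast
    have "P (Suc n) (g + u)"
      unfolding P_def uniform_ball_def
    proof (intro CollectI conjI ballI)
      show "g + u \<in> continuous_functions X" using gC u(1) nbhd_subset by (auto intro: continuous_functions_add)
      fix x assume x: "x \<in> C (Suc n)"
      have "h x = f x" using x CK(2) h(2) by blast
      moreover have "\<bar>u x - (h - g) x\<bar> < \<epsilon> (Suc n)" using u(2) x by (simp add: uniform_ball_def)
      ultimately show "\<bar>(g + u) x - f x\<bar> < \<epsilon> (Suc n)" by (simp add: algebra_simps)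
    qed
    then show "\<exists>h. P (Suc n) h \<and> h - g \<in> nbhd n" using u(1) by (intro exI[of _ "g + u"]) simp
  qed
  then obtain F where F: "\<And>n. P n (F n)" and step: "\<And>n. F (Suc n) - F n \<in> nbhd n" by blast
  have FC: "F n \<in> continuous_functions X" for n using F[of n] by (simp add: P_def uniform_ball_def)
  obtain g where g: "g \<in> continuous_functions X" "\<And>x. (\<lambda>n. F n x) \<longlonglongrightarrow> g x"
    using increments_converge[OF FC step] by blast
  have "g x = f x" for x
  proof (cases "x \<in> topspace X")
    case True
    then obtain k where k: "x \<in> K k" using stages_cover by blast
    have "\<bar>F n x - f x\<bar> < 1 / real (Suc n)" if "n \<ge> k" for n
    proof -
      have "K k \<subseteq> C n" unfolding C_def by (rule incseqD[OF incseq_stages]) (use that in simp)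
      then have "\<bar>F n x - f x\<bar> < \<epsilon> n" using F[of n] k by (auto simp: P_def uniform_ball_def)
      then show ?thesis by (simp add: \<epsilon>_def)
    qed
    then have "\<forall>\<^sub>F n in sequentially. norm (F n x - f x) \<le> 1 / real (Suc n)"
      by (intro eventually_sequentiallyI[of k]) (simp add: less_imp_le)
    then have "(\<lambda>n. F n x - f x) \<longlonglongrightarrow> 0"
      by (rule Lim_null_comparison) (rule LIMSEQ_Suc[OF lim_1_over_n])
    then have "(\<lambda>n. F n x) \<longlonglongrightarrow> f x" by (simp add: LIM_zero_iff)
    then show ?thesis using g(2) LIMSEQ_unique by blast
  next
    case False
    then show ?thesis using g(1) f by (simp add: continuous_functions_def stagewise_continuous_def)
  qed
  then have "g = f" by (rule ext)
  then show "f \<in> continuous_functions X" using g(1) by simp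
qed

end

lemma polishable_Cp_imp_submetrizable_hemicompact_k_space:
  assumes X: "tychonoff_space X" and P: "polishable (Cp X)"
  shows "submetrizable_space X" "hemicompact_space X" "k_space X"
proof -
  obtain T where T: "topspace T = continuous_functions X" "\<And>U. openin (Cp X) U \<Longrightarrow> openin T U"
    "frechet_space T" "separable_space T"
    using P unfolding polishable_def by auto
  show "submetrizable_space X" by (rule separable_finer_than_Cp_imp_submetrizable[OF X T(1,2,4)])
  interpret frechet_finer_than_Cp X T using X T by unfold_locales
  show "hemicompact_space X" by (rule hemicompact)
  then obtain K where K: "compact_exhaustion X K"
    using hemicompact_space_imp_compact_exhaustion by blast
  then show "k_space X"
    using compact_exhaustion.stagewise_imp_k_space[OF K] stagewise_imp_continuous[OF K] X
    by (simp add: tychonoff_space_def)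
qed

theorem theorem2:
  fixes X :: "'a topology"
  assumes "tychonoff_space X"
  shows "(polishable (Cp X) \<longleftrightarrow> polish_topology (Ck X)) \<and>
         (polish_topology (Ck X) \<longleftrightarrow>
            submetrizable_space X \<and> hemicompact_space X \<and> k_space X)"
proof -
  let ?c = "submetrizable_space X \<and> hemicompact_space X \<and> k_space X"
  have "?c" if "polishable (Cp X)"
    using polishable_Cp_imp_submetrizable_hemicompact_k_space[OF assms that] by simp
  moreover have "?c" if "polish_topology (Ck X)"
    using polish_Ck_imp_submetrizable_hemicompact_k_space[OF assms that] by simp
  moreover have "polishable (Cp X)" "polish_topology (Ck X)" if "?c"
  proof -
    have "frechet_space (Ck X)" "separable_space (Ck X)"
      using submetrizable_hemicompact_k_space_imp_frechet_Ck that by blast+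
    then show "polishable (Cp X)" "polish_topology (Ck X)"
      using Ck_finer_than_Cp[of X] frechet_imp_completely_metrizable[of "Ck X"]
      unfolding polishable_def polish_topology_def by (auto intro!: exI[of _ "Ck X"])
  qed
  ultimately show ?thesis by blast
qed

end
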